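(* Let $n\in\mathbb{N}$ and, for each $j\in\{1,\dots,n\}$, let $(\lambda_k^j)_{k\in\mathbb{N}}$ be a sequence of complex numbers with $\Re\lambda_k^j>0$ for all $k\in\mathbb{N}$. Then all of $(\lambda_k^1)_{k\in\mathbb{N}},\dots,(\lambda_k^n)_{k\in\mathbb{N}}$ are uniqueness sequences for the one-dimensional Laplace transform if and only if $((\lambda_{k_1}^1,\dots,\lambda_{k_n}^n))_{(k_1,\dots,k_n)\in\mathbb{N}^n}$ is a uniqueness sequence for the multidimensional Laplace transform (in $\mathbb{R}^n$).
   Context: One-dimensional notion: for a locally integrable $f:[0,+\infty)\to\mathbb{C}$, write $\hat f(\lambda)=\lim_{t\to+\infty}\int_0^te^{-\lambda s}f(s)\,ds$ when the limit exists, and $\mathrm{abs}(f)=\inf\{\Re\lambda:\hat f(\lambda)\text{ exists}\}$. A complex sequence $(\lambda_k)_{k\in\mathbb{N}}$ is a uniqueness sequence for the (one-dimensional) Laplace transform if for every locally integrable $f:[0,+\infty)\to\mathbb{C}$ such that $\mathrm{abs}(f)<\Re\lambda_k$ and $\hat f(\lambda_k)=0$ for all $k\in\mathbb{N}$, we have $f=0$ a.e. Multidimensional notion: for a locally integrable function $f:[0,+\infty)^n\to\mathbb{C}$ (integrable on every $[0,T]^n$) and $(\lambda_1,\dots,\lambda_n)\in\mathbb{C}^n$, put $I(t_1,\dots,t_n)=\int_0^{t_1}\cdots\int_0^{t_n}e^{-\lambda_1s_1-\dots-\lambda_ns_n}f(s_1,\dots,s_n)\,ds_1\cdots ds_n$.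 Let $\Omega(f)$ be the set of all $(\lambda_1,\dots,\lambda_n)\in\mathbb{C}^n$ for which the limit $\hat f(\lambda_1,\dots,\lambda_n):=\lim_{t_1\to+\infty;\dots;t_n\to+\infty}I(t_1,\dots,t_n)$ (all $t_i$ tending to $+\infty$ jointly) exists, and let $\Omega_b(f)$ be the set of all $(\lambda_1,\dots,\lambda_n)\in\mathbb{C}^n$ for which $\{I(t_1,\dots,t_n): t_1,\dots,t_n\ge 0\}$ is bounded. A sequence $((\mu_k^1,\dots,\mu_k^n))_{k\in\mathbb{N}}$ in $\mathbb{C}^n$ is a uniqueness sequence for the multidimensional Laplace transform (in $\mathbb{R}^n$) if the following holds for every locally integrable $f:[0,+\infty)^n\to\mathbb{C}$: if there exist $\omega_1,\dots,\omega_n\in[-\infty,+\infty)$ with $\{\Re\lambda_1>\omega_1\}\times\dots\times\{\Re\lambda_n>\omega_n\}\subseteq\Omega_b(f)\cap\Omega(f)$ and $\omega_j<\Re\mu_k^j$ for all $k\in\mathbb{N}$, $1\le j\le n$, and if $\hat f(\mu_k^1,\dots,\mu_k^n)=0$ for all $k\in\mathbb{N}$, then $f=0$ a.e. This depends only on the set of values of the sequence; a family indexed by a countably infinite set such as $\mathbb{N}^n$ is regarded as a sequence via any enumeration. *)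

theory Defs
  imports "HOL-Analysis.Analysis"
begin

section \<open>The one-dimensional Laplace transform\<close>

text \<open>
  Functions on \<open>[0,\<infinity>)\<close> (resp. \<open>[0,\<infinity>)\<^sup>n\<close>) are represented by total functions on \<^typ>\<open>real\<close>
  (resp. \<open>real ^ 'n\<close>) of which only the values at nonnegative arguments are ever used.
\<close>

definition loc_integrable :: "(real \<Rightarrow> complex) \<Rightarrow> bool" where
  "loc_integrable f \<longleftrightarrow> (\<forall>T. f absolutely_integrable_on {0..T})"

definition laplace_partial :: "(real \<Rightarrow> complex) \<Rightarrow> complex \<Rightarrow> real \<Rightarrow> complex" where
  "laplace_partial f z t =
     (LINT s:{0..t}|lebesgue. exp (- (z * complex_of_real s)) * f s)"

text \<open>\<open>has_laplace f z L\<close> says that the limit defining the transform at \<open>z\<close> exists and equals \<open>L\<close>.\<close>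

definition has_laplace :: "(real \<Rightarrow> complex) \<Rightarrow> complex \<Rightarrow> complex \<Rightarrow> bool" where
  "has_laplace f z L \<longleftrightarrow> (laplace_partial f z \<longlongrightarrow> L) at_top"

definition laplace_abscissa :: "(real \<Rightarrow> complex) \<Rightarrow> ereal" where
  "laplace_abscissa f = Inf {ereal (Re z) | z. \<exists>L. has_laplace f z L}"

definition laplace_uniqueness_seq :: "(nat \<Rightarrow> complex) \<Rightarrow> bool" where
  "laplace_uniqueness_seq \<mu> \<longleftrightarrow>
     (\<forall>f. loc_integrable f \<longrightarrow>
          (\<forall>k. laplace_abscissa f < ereal (Re (\<mu> k))) \<longrightarrow>
          (\<forall>k. has_laplace f (\<mu> k) 0) \<longrightarrow>
          (AE x in lebesgue. 0 \<le> x \<longrightarrow> f x = 0))"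


section \<open>The multidimensional Laplace transform\<close>

text \<open>
  The order on \<open>real ^ 'n\<close> is componentwise, so \<open>{0..t}\<close> is the box with sides \<open>[0, t $ i]\<close>
  and \<^const>\<open>at_top\<close> describes all coordinates tending to \<open>+\<infinity>\<close> jointly.
\<close>

lemma eventually_at_top_vec:
  "eventually P (at_top :: (real ^ 'n) filter) \<longleftrightarrow>
     (\<exists>T::real. \<forall>t. (\<forall>i. T \<le> t $ i) \<longrightarrow> P t)"
proof -
  have "eventually P (at_top :: (real ^ 'n) filter) \<longleftrightarrow>
      (\<exists>a\<in>(UNIV :: (real ^ 'n) set). eventually P (principal {a..}))"
    unfolding at_top_def
  proof (rule eventually_INF_base)
    fix a b :: "real ^ 'n"
    have "principal {(\<chi> i. max (a $ i) (b $ i))..} \<le> inf (principal {a..}) (principal {b..})"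
      by (auto simp: less_eq_vec_def)
    then show "\<exists>x\<in>UNIV. principal {x..} \<le> inf (principal {a..}) (principal {b..})"
      by blast
  qed auto
  also have "\<dots> \<longleftrightarrow> (\<exists>T::real. \<forall>t. (\<forall>i. T \<le> t $ i) \<longrightarrow> P t)"
  proof
    assume "\<exists>a\<in>(UNIV :: (real ^ 'n) set). eventually P (principal {a..})"
    then obtain a :: "real ^ 'n" where a: "\<And>t. a \<le> t \<Longrightarrow> P t"
      by (auto simp: eventually_principal)
    have "a $ i \<le> Max (range (($) a))" for i
      by (rule Max_ge) auto
    then have "\<forall>t. (\<forall>i. Max (range (($) a)) \<le> t $ i) \<longrightarrow> P t"
      by (auto intro!: a simp: less_eq_vec_def intro: order_trans)
    then show "\<exists>T::real. \<forall>t. (\<forall>i. T \<le> t $ i) \<longrightarrow> P t" ..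
  next
    assume "\<exists>T::real. \<forall>t. (\<forall>i. T \<le> t $ i) \<longrightarrow> P t"
    then obtain T :: real where "\<And>t. (\<forall>i. T \<le> t $ i) \<Longrightarrow> P t" by blast
    then have "eventually P (principal {(\<chi> i. T)..})"
      by (auto simp: eventually_principal less_eq_vec_def)
    then show "\<exists>a\<in>(UNIV :: (real ^ 'n) set). eventually P (principal {a..})" by blast
  qed
  finally show ?thesis .
qed

definition multi_loc_integrable :: "(real ^ 'n \<Rightarrow> complex) \<Rightarrow> bool" where
  "multi_loc_integrable f \<longleftrightarrow> (\<forall>T::real. f absolutely_integrable_on {0..(\<chi> i. T)})"

definition multi_laplace_partial ::
    "(real ^ 'n \<Rightarrow> complex) \<Rightarrow> complex ^ 'n \<Rightarrow> real ^ 'n \<Rightarrow> complex" where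
  "multi_laplace_partial f z t =
     (LINT s:{0..t}|lebesgue. exp (- (\<Sum>i\<in>UNIV. z $ i * complex_of_real (s $ i))) * f s)"

definition has_multi_laplace ::
    "(real ^ 'n \<Rightarrow> complex) \<Rightarrow> complex ^ 'n \<Rightarrow> complex \<Rightarrow> bool" where
  "has_multi_laplace f z L \<longleftrightarrow> (multi_laplace_partial f z \<longlongrightarrow> L) at_top"

definition laplace_Omega :: "(real ^ 'n \<Rightarrow> complex) \<Rightarrow> (complex ^ 'n) set" where
  "laplace_Omega f = {z. \<exists>L. has_multi_laplace f z L}"

definition laplace_Omega_b :: "(real ^ 'n \<Rightarrow> complex) \<Rightarrow> (complex ^ 'n) set" where
  "laplace_Omega_b f = {z. bounded {multi_laplace_partial f z t | t. 0 \<le> t}}"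

text \<open>
  The notion is stated for families over an arbitrary index type, sequences being the case
  \<^typ>\<open>nat\<close>; the lemma below shows that enumerating the index type makes no difference.
\<close>

definition multi_laplace_uniqueness :: "('k \<Rightarrow> complex ^ 'n) \<Rightarrow> bool" where
  "multi_laplace_uniqueness \<mu> \<longleftrightarrow>
     (\<forall>f. multi_loc_integrable f \<longrightarrow>
          (\<exists>\<omega> :: 'n \<Rightarrow> ereal.
             (\<forall>j. \<omega> j < \<infinity>) \<and>
             {z. \<forall>j. \<omega> j < ereal (Re (z $ j))} \<subseteq> laplace_Omega_b f \<inter> laplace_Omega f \<and>
             (\<forall>k j. \<omega> j < ereal (Re (\<mu> k $ j)))) \<longrightarrow>
          (\<forall>k. has_multi_laplace f (\<mu> k) 0) \<longrightarrow>
          (AE x in lebesgue. 0 \<le> x \<longrightarrow> f x = 0))"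

lemma multi_laplace_uniqueness_enumeration:
  fixes \<mu> :: "'k \<Rightarrow> complex ^ 'n" and e :: "nat \<Rightarrow> 'k"
  assumes "surj e"
  shows "multi_laplace_uniqueness (\<lambda>m. \<mu> (e m)) \<longleftrightarrow> multi_laplace_uniqueness \<mu>"
proof -
  have "(\<forall>m. Q (e m)) \<longleftrightarrow> (\<forall>k. Q k)" for Q
    using assms by (metis surjD)
  from this[of "\<lambda>k. \<forall>j. _ j < ereal (Re (\<mu> k $ j))"] this[of "\<lambda>k. has_multi_laplace _ (\<mu> k) 0"]
  show ?thesis
    unfolding multi_laplace_uniqueness_def by simp
qed

end

theory Submission
  imports Defs
begin

text \<open>
  One direction is a tensor product argument. If \<open>h\<close> is a function of one variable whose
  transform vanishes along the sequence with index \<open>j\<close>, then \<open>h(x\<^sub>j)\<close> times the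
  indicators of \<open>0 \<le> x\<^sub>i \<le> 1\<close> for \<open>i \<noteq> j\<close> has a transform that factorises and
  vanishes on the grid. Multidimensional uniqueness makes this tensor product, and hence \<open>h\<close>,
  vanish (\<open>laplace_uniqueness_seq_component\<close>).

  For the other direction one would like to freeze all variables but one and apply uniqueness in that
  variable. The function \<open>f\<close> itself does not allow this: its transform converges only
  conditionally, and integrating out some of the variables need not leave a locally integrable function.
  The remedy is to work with the primitive \<open>P(t) = \<integral>\<^bsub>[0,t]\<^esub> f\<close>, which is
  \<open>multi_laplace_partial f 0\<close>. The hypothesis \<open>0 < Re \<lambda>\<close> enters here: every \<open>\<omega>\<^sub>j\<close>
  may be replaced by \<open>max 0 \<omega>\<^sub>j\<close>, and for nonnegative \<open>\<omega>\<close> the boundedness of the partial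
  transforms yields \<open>P(t) = O(exp(b \<bullet> t))\<close> whenever \<open>\<omega>\<^sub>j < b\<^sub>j\<close> for all \<open>j\<close>. Hence the
  transform of \<open>P\<close> converges absolutely for \<open>\<omega>\<^sub>j < Re z\<^sub>j\<close>, and there the transform of
  \<open>f\<close> is \<open>z\<^sub>1 \<cdots> z\<^sub>n\<close> times that of \<open>P\<close> (\<open>laplace_transform_primitive\<close>). Since no
  coordinate of a grid point is \<open>0\<close>, the transform of \<open>P\<close> vanishes on the grid.

  Absolute convergence makes Fubini's theorem applicable, so \<open>P = 0\<close> almost everywhere follows by
  induction on the number of variables, with one application of one-dimensional uniqueness per variable
  (\<open>laplace_uniqueness_PiM\<close>). Continuity from above upgrades this to \<open>P = 0\<close> everywhere
  (\<open>primitive_eq_0_if_AE\<close>), and a function whose integrals over all boxes \<open>[0,t]\<close> vanish is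
  zero almost everywhere (\<open>AE_eq_0_if_box_integrals_0\<close>).
\<close>

section \<open>Lebesgue measure on finite products\<close>

lemma measurable_vec_lambda_PiM [measurable]:
  "(\<lambda>x. \<chi> i. x i) \<in> measurable (Pi\<^sub>M (UNIV::'n::finite set) (\<lambda>_. lborel :: real measure)) borel"
  by (subst borel_measurable_euclidean_space) (auto simp: Basis_vec_def inner_axis)

text \<open>
  Fubini's theorem one coordinate at a time concerns product measures indexed by the coordinates;
  this identity transports it to vectors.
\<close>

lemma lborel_vec_eq_distr_PiM:
  "(lborel :: (real ^ 'n) measure) = distr (Pi\<^sub>M UNIV (\<lambda>_. lborel)) borel (\<lambda>x. \<chi> i. x i)"
proof (rule lborel_eqI)
  interpret product_sigma_finite "\<lambda>_::'n. lborel :: real measure" by standard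
  have meas: "(\<lambda>x. \<chi> i. x i) \<in> measurable (Pi\<^sub>M (UNIV::'n set) (\<lambda>_. lborel :: real measure)) borel"
    by (rule measurable_vec_lambda_PiM)
  fix l u :: "real ^ 'n"
  assume le: "\<And>b. b \<in> Basis \<Longrightarrow> l \<bullet> b \<le> u \<bullet> b"
  have le': "l $ i \<le> u $ i" for i
    using le[of "axis i 1"] by (auto simp: Basis_vec_def inner_axis)
  have "emeasure (distr (Pi\<^sub>M UNIV (\<lambda>_. lborel)) borel (\<lambda>x. \<chi> i. x i)) (box l u)
      = emeasure (Pi\<^sub>M (UNIV::'n set) (\<lambda>_. lborel)) (Pi\<^sub>E UNIV (\<lambda>i. {l $ i<..<u $ i}))"
    by (subst emeasure_distr[OF meas])
       (auto intro!: arg_cong[where f="emeasure _"] simp: space_PiM mem_box_cart PiE_def Pi_def)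
  also have "\<dots> = (\<Prod>i\<in>UNIV. ennreal (u $ i - l $ i))"
    by (subst emeasure_PiM) (auto simp: le')
  also have "\<dots> = ennreal (\<Prod>i\<in>UNIV. u $ i - l $ i)"
    by (rule prod_ennreal) (simp add: le')
  also have "(\<Prod>i\<in>UNIV. u $ i - l $ i) = (\<Prod>b\<in>Basis. (u - l) \<bullet> b)"
  proof -
    have B: "(Basis :: (real^'n) set) = range (\<lambda>i. axis i 1)"
      by (auto simp: Basis_vec_def)
    have inj: "inj (\<lambda>i::'n. axis i (1::real))"
      by (auto simp: inj_on_def axis_eq_axis)
    show ?thesis
      unfolding B prod.reindex[OF inj] by (simp add: inner_axis)
  qed
  finally show "emeasure (distr (Pi\<^sub>M UNIV (\<lambda>_. lborel)) borel (\<lambda>x. \<chi> i. x i)) (box l u)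
      = (\<Prod>b\<in>Basis. (u - l) \<bullet> b)" .
qed simp

lemma
  fixes \<phi> :: "'n::finite \<Rightarrow> real \<Rightarrow> complex"
  assumes "\<And>i. integrable lborel (\<phi> i)"
  shows integrable_vec_prod: "integrable lborel (\<lambda>x::real^'n. \<Prod>i\<in>UNIV. \<phi> i (x $ i))"
    and integral_vec_prod:
      "(\<integral>x. (\<Prod>i\<in>UNIV. \<phi> i ((x::real^'n) $ i)) \<partial>lborel) = (\<Prod>i\<in>UNIV. integral\<^sup>L lborel (\<phi> i))"
proof -
  interpret product_sigma_finite "\<lambda>_::'n. lborel :: real measure" by standard
  have [measurable]: "\<phi> i \<in> borel_measurable borel" for i
    using borel_measurable_integrable[OF assms[of i]] by simp
  show "integrable lborel (\<lambda>x::real^'n. \<Prod>i\<in>UNIV. \<phi> i (x $ i))"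
    by (subst lborel_vec_eq_distr_PiM, subst integrable_distr_eq)
       (auto intro!: product_integrable_prod assms)
  show "(\<integral>x. (\<Prod>i\<in>UNIV. \<phi> i ((x::real^'n) $ i)) \<partial>lborel) = (\<Prod>i\<in>UNIV. integral\<^sup>L lborel (\<phi> i))"
    by (subst lborel_vec_eq_distr_PiM, subst integral_distr)
       (auto simp: product_integral_prod assms)
qed

text \<open>
  The transforms are integrals against the completed measure, whereas Fubini arguments require
  functions measurable for the product of Borel algebras. A function that is integrable on each of
  the Borel sets exhausting \<open>U\<close> is therefore replaced by a Borel function with the same set
  integrals; below \<open>U\<close> is an orthant and the exhaustion consists of boxes.
\<close>

lemma ex_borel_version_on_union:
  fixes f :: "'a::euclidean_space \<Rightarrow> complex" and A :: "nat \<Rightarrow> 'a set"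
  assumes "\<And>N. set_integrable lebesgue (A N) f" "incseq A" "\<And>N. A N \<in> sets borel"
    and U: "(\<Union>N. A N) = U"
  obtains g where "g \<in> borel_measurable borel" "\<And>x. x \<notin> U \<Longrightarrow> g x = 0"
    "AE x in lborel. x \<in> U \<longrightarrow> f x = g x"
    "\<And>B k. B \<in> sets borel \<Longrightarrow> B \<subseteq> U \<Longrightarrow> k \<in> borel_measurable borel \<Longrightarrow>
      (LINT x:B|lebesgue. k x * f x) = (LINT x:B|lborel. k x * g x)"
    "\<And>N. set_integrable lborel (A N) g"
proof -
  have [measurable]: "A N \<in> sets borel" for N by fact
  have [measurable]: "U \<in> sets borel" using assms(3) unfolding U[symmetric] by auto
  have meas: "(\<lambda>x. indicator U x *\<^sub>R f x) \<in> borel_measurable lebesgue"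
  proof (rule borel_measurable_LIMSEQ_metric)
    show "(\<lambda>x. indicator (A N) x *\<^sub>R f x) \<in> borel_measurable lebesgue" for N
      using assms(1)[of N] unfolding set_integrable_def by (rule borel_measurable_integrable)
    show "(\<lambda>N. indicator (A N) x *\<^sub>R f x) \<longlonglongrightarrow> indicator U x *\<^sub>R f x" for x
      unfolding U[symmetric] by (intro tendsto_intros LIMSEQ_indicator_incseq assms(2))
  qed
  obtain g1 where g1: "g1 \<in> borel_measurable lborel"
      "AE x in lborel. Re (indicator U x *\<^sub>R f x) = g1 x"
    using completion_ex_borel_measurable_real[OF measurable_compose[OF meas borel_measurable_Re]] by blast
  obtain g2 where g2: "g2 \<in> borel_measurable lborel"
      "AE x in lborel. Im (indicator U x *\<^sub>R f x) = g2 x"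
    using completion_ex_borel_measurable_real[OF measurable_compose[OF meas borel_measurable_Im]] by blast
  have [measurable]: "g1 \<in> borel_measurable borel" "g2 \<in> borel_measurable borel"
    using g1(1) g2(1) by auto
  define g where "g x = indicator U x *\<^sub>R (of_real (g1 x) + \<i> * of_real (g2 x))" for x
  have g[measurable]: "g \<in> borel_measurable borel"
    unfolding g_def by measurable
  have AE: "AE x in lborel. x \<in> U \<longrightarrow> f x = g x"
    using g1(2) g2(2) by eventually_elim (auto simp: g_def complex_eq_iff)
  have ind: "indicator B x *\<^sub>R (k x * f x) = indicator B x *\<^sub>R (k x * (indicator U x *\<^sub>R f x))"
    if "B \<subseteq> U" for B x and k :: "'a \<Rightarrow> complex"
    using that by (auto simp: indicator_def)
  have eq: "(\<lambda>x. indicator B x *\<^sub>R (k x * f x)) \<in> borel_measurable lebesgue"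
      "AE x in lebesgue. indicator B x *\<^sub>R (k x * f x) = indicator B x *\<^sub>R (k x * g x)"
    if B: "B \<in> sets borel" "B \<subseteq> U" and k: "k \<in> borel_measurable borel" for B and k :: "'a \<Rightarrow> complex"
  proof -
    have "indicator B \<in> borel_measurable lebesgue" "k \<in> borel_measurable lebesgue"
      using B k by (auto intro!: measurable_completion)
    then show "(\<lambda>x. indicator B x *\<^sub>R (k x * f x)) \<in> borel_measurable lebesgue"
      unfolding ind[OF B(2)]
      by (intro borel_measurable_scaleR borel_measurable_times meas)
    have "AE x in lebesgue. x \<in> U \<longrightarrow> f x = g x"
      using AE by (rule AE_completion)
    then show "AE x in lebesgue. indicator B x *\<^sub>R (k x * f x) = indicator B x *\<^sub>R (k x * g x)"
      by eventually_elim (use B(2) in \<open>auto simp: indicator_def\<close>)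
  qed
  show thesis
  proof (rule that[OF g _ AE])
    show "g x = 0" if "x \<notin> U" for x using that by (simp add: g_def)
    show "(LINT x:B|lebesgue. k x * f x) = (LINT x:B|lborel. k x * g x)"
      if [measurable]: "B \<in> sets borel" and "B \<subseteq> U" and [measurable]: "k \<in> borel_measurable borel"
      for B and k :: "'a \<Rightarrow> complex"
    proof -
      have "(LINT x:B|lebesgue. k x * f x) = (LINT x:B|lebesgue. k x * g x)"
        unfolding set_lebesgue_integral_def
        by (rule integral_cong_AE[OF eq(1) _ eq(2)]) (use that in \<open>auto intro!: measurable_completion\<close>)
      also have "\<dots> = (LINT x:B|lborel. k x * g x)"
        unfolding set_lebesgue_integral_def by (rule integral_completion) measurable
      finally show ?thesis .
    qed
    show "set_integrable lborel (A N) g" for N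
    proof -
      have AN: "A N \<subseteq> U" unfolding U[symmetric] by auto
      have "(\<lambda>x. indicator (A N) x *\<^sub>R g x) \<in> borel_measurable lebesgue"
        by (rule measurable_completion) measurable
      then have "integrable lebesgue (\<lambda>x. indicator (A N) x *\<^sub>R f x) \<longleftrightarrow>
          integrable lebesgue (\<lambda>x. indicator (A N) x *\<^sub>R g x)"
        using eq[OF _ AN, of "\<lambda>_. 1"] by (intro integrable_cong_AE) auto
      then have "integrable lebesgue (\<lambda>x. indicator (A N) x *\<^sub>R g x)"
        using assms(1)[of N] by (simp add: set_integrable_def)
      then show ?thesis
        unfolding set_integrable_def by (subst (asm) integrable_completion) auto
    qed
  qed
qed

text \<open>
  The positive and the negative part of \<open>g\<close> are densities of two measures that agree, with
  finite values, on all lower orthants. These form a generator of the Borel algebra that is stable under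
  intersection, so the measures and hence the densities coincide.
\<close>

lemma AE_eq_0_if_box_integrals_0_real:
  fixes g :: "real ^ 'n \<Rightarrow> real"
  assumes [measurable]: "g \<in> borel_measurable borel"
    and supp: "\<And>x. \<not> 0 \<le> x \<Longrightarrow> g x = 0"
    and int: "\<And>t. integrable lborel (\<lambda>x. indicator {0..t} x *\<^sub>R g x)"
    and zero: "\<And>t. (\<integral>x. indicator {0..t} x *\<^sub>R g x \<partial>lborel) = 0"
  shows "AE x in lborel. g x = 0"
proof -
  let ?p = "\<lambda>x. ennreal (g x)" and ?m = "\<lambda>x. ennreal (- g x)"
  have ind: "?p x * indicator {..t} x = ennreal (indicator {0..t} x *\<^sub>R g x)"
    "?m x * indicator {..t} x = ennreal (- (indicator {0..t} x *\<^sub>R g x))" for x t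
    using supp[of x] by (auto split: split_indicator)
  have fin: "(\<integral>\<^sup>+x. ennreal (indicator {0..t} x *\<^sub>R g x) \<partial>lborel) < \<infinity>"
    "(\<integral>\<^sup>+x. ennreal (- (indicator {0..t} x *\<^sub>R g x)) \<partial>lborel) < \<infinity>" for t
    using int[of t] by (auto simp: real_integrable_def less_top)
  have eq: "(\<integral>\<^sup>+x. ennreal (indicator {0..t} x *\<^sub>R g x) \<partial>lborel) =
      (\<integral>\<^sup>+x. ennreal (- (indicator {0..t} x *\<^sub>R g x)) \<partial>lborel)" for t
  proof -
    have "enn2real (\<integral>\<^sup>+x. ennreal (indicator {0..t} x *\<^sub>R g x) \<partial>lborel) =
        enn2real (\<integral>\<^sup>+x. ennreal (- (indicator {0..t} x *\<^sub>R g x)) \<partial>lborel)"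
      using zero[of t] unfolding real_lebesgue_integral_def[OF int] by simp
    then show ?thesis
      using fin[of t] by (metis ennreal_enn2real infinity_ennreal_def)
  qed
  have gen: "sets borel = sigma_sets UNIV (range (\<lambda>t::real^'n. {..t}))"
    by (subst borel_eq_atMost) simp
  have "density lborel ?p = density lborel ?m"
  proof (rule measure_eqI_generator_eq[where E="range (\<lambda>t::real^'n. {..t})" and \<Omega>=UNIV
        and A="\<lambda>N::nat. {..(\<chi> i. real N)}"])
    show "Int_stable (range (\<lambda>t::real^'n. {..t}))"
    proof -
      have "{..a} \<inter> {..b} = {..(\<chi> i. min (a $ i) (b $ i))}" for a b :: "real^'n"
        by (auto simp: less_eq_vec_def)
      then show ?thesis
        unfolding Int_stable_def by blast
    qed
    show "emeasure (density lborel ?p) X = emeasure (density lborel ?m) X"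
      if "X \<in> range (\<lambda>t::real^'n. {..t})" for X
      using that by (auto simp: emeasure_density ind eq simp del: real_scaleR_def)
    show "emeasure (density lborel ?p) {..(\<chi> i. real N)} \<noteq> \<infinity>" for N :: nat
      using fin(1)[of "\<chi> i. real N"] by (auto simp: emeasure_density ind simp del: real_scaleR_def)
    show "(\<Union>N::nat. {..((\<chi> i. real N) :: real^'n)}) = UNIV"
    proof (intro equalityI subsetI UNIV_I)
      fix x :: "real^'n"
      obtain N :: nat where "norm x \<le> real N" using real_arch_simple by blast
      then have "x \<le> (\<chi> i. real N)"
        using component_le_norm_cart[of x] by (auto simp: less_eq_vec_def intro: order_trans abs_le_D1)
      then show "x \<in> (\<Union>N::nat. {..(\<chi> i. real N)})" by auto
    qed
  qed (use gen in auto)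
  then have "AE x in lborel. ?p x = ?m x"
    by (subst (asm) sigma_finite_measure.density_unique_iff[OF sigma_finite_lborel]) auto
  then show ?thesis
  proof eventually_elim
    case (elim x)
    then show ?case
      by (cases "g x" "0::real" rule: linorder_cases) (auto simp: ennreal_neg)
  qed
qed

lemma AE_eq_0_if_box_integrals_0:
  fixes g :: "real ^ 'n \<Rightarrow> complex"
  assumes [measurable]: "g \<in> borel_measurable borel"
    and supp: "\<And>x. \<not> 0 \<le> x \<Longrightarrow> g x = 0"
    and int: "\<And>t. integrable lborel (\<lambda>x. indicator {0..t} x *\<^sub>R g x)"
    and zero: "\<And>t. (\<integral>x. indicator {0..t} x *\<^sub>R g x \<partial>lborel) = 0"
  shows "AE x in lborel. g x = 0"
proof -
  have "AE x in lborel. Re (g x) = 0"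
    using integral_Re[OF int] integrable_Re[OF int] zero supp
    by (intro AE_eq_0_if_box_integrals_0_real) auto
  moreover have "AE x in lborel. Im (g x) = 0"
    using integral_Im[OF int] integrable_Im[OF int] zero supp
    by (intro AE_eq_0_if_box_integrals_0_real) auto
  ultimately show ?thesis by eventually_elim (simp add: complex_eq_iff)
qed

section \<open>Integrals of exponentials\<close>

lemma integral_cexp_Icc:
  fixes z :: complex
  assumes "a \<le> b"
  shows "z * (\<integral>r. indicator {a..b} r *\<^sub>R exp (- (z * of_real r)) \<partial>lborel)
      = exp (- (z * of_real a)) - exp (- (z * of_real b))"
    and "integrable lborel (\<lambda>r. indicator {a..b} r *\<^sub>R exp (- (z * of_real r)))"
proof -
  have "((\<lambda>r. - exp (- (z * of_real r))) has_vector_derivative z * exp (- (z * of_real x)))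
      (at x within {a..b})" for x :: real
    by (rule has_vector_derivative_real_field) (auto intro!: derivative_eq_intros)
  moreover have "continuous_on {a..b} (\<lambda>r. z * exp (- (z * of_real r)))"
    by (intro continuous_intros)
  ultimately have *: "has_bochner_integral lborel (\<lambda>r. indicator {a..b} r *\<^sub>R (z * exp (- (z * of_real r))))
      (exp (- (z * of_real a)) - exp (- (z * of_real b)))"
    using has_bochner_integral_FTC_Icc[OF assms, of "\<lambda>r. - exp (- (z * of_real r))"] by simp
  show I: "integrable lborel (\<lambda>r. indicator {a..b} r *\<^sub>R exp (- (z * of_real r)))"
    by (intro borel_integrable_compact continuous_intros) auto
  show "z * (\<integral>r. indicator {a..b} r *\<^sub>R exp (- (z * of_real r)) \<partial>lborel)
      = exp (- (z * of_real a)) - exp (- (z * of_real b))"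
    using has_bochner_integral_integral_eq[OF *] by (simp flip: integral_mult_right_zero)
qed

text \<open>
  Changes the exponent of a transform in one direction. The identity
  \<open>exp(- w p) = exp(- w T) + w \<integral>\<^bsub>[p,T]\<^esub> exp(- w r) dr\<close> is inserted under the integral
  and the order of integration is exchanged; the inner integrals become truncations of
  \<open>\<integral> g\<close>. With an abstract measure and an abstract coordinate function \<open>\<pi>\<close> this serves both the
  half-line and each single coordinate of a vector.
\<close>

lemma integral_cexp_by_parts:
  fixes g :: "'a \<Rightarrow> complex" and \<pi> :: "'a \<Rightarrow> real" and w :: complex
  assumes "sigma_finite_measure M" and g: "integrable M g" and [measurable]: "\<pi> \<in> borel_measurable M"
    and supp: "\<And>s. g s \<noteq> 0 \<Longrightarrow> 0 \<le> \<pi> s \<and> \<pi> s \<le> T"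
  shows "(\<integral>s. exp (- (w * of_real (\<pi> s))) * g s \<partial>M) = exp (- (w * of_real T)) * (\<integral>s. g s \<partial>M)
      + w * (\<integral>r. indicator {0..T} r *\<^sub>R (exp (- (w * of_real r)) * (\<integral>s. indicator {..r} (\<pi> s) *\<^sub>R g s \<partial>M)) \<partial>lborel)"
proof -
  interpret sigma_finite_measure M by fact
  interpret pair_sigma_finite M lborel by standard
  have [measurable]: "g \<in> borel_measurable M" using g by auto
  let ?e = "\<lambda>r::real. indicator {0..T} r *\<^sub>R exp (- (w * of_real r))"
  let ?F = "\<lambda>s r. indicator {..r} (\<pi> s) *\<^sub>R (?e r * g s)"
  have e: "integrable lborel ?e"
  proof (cases "0 \<le> T")
    case True then show ?thesis by (rule integral_cexp_Icc)
  qed simp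
  have inner: "w * (\<integral>r. ?F s r \<partial>lborel) = (exp (- (w * of_real (\<pi> s))) - exp (- (w * of_real T))) * g s" for s
  proof (cases "g s = 0")
    case False
    then have pi: "0 \<le> \<pi> s" "\<pi> s \<le> T" using supp by auto
    have "(\<integral>r. ?F s r \<partial>lborel) = (\<integral>r. (indicator {\<pi> s..T} r *\<^sub>R exp (- (w * of_real r))) * g s \<partial>lborel)"
      using pi by (intro Bochner_Integration.integral_cong) (auto split: split_indicator)
    also have "\<dots> = (\<integral>r. indicator {\<pi> s..T} r *\<^sub>R exp (- (w * of_real r)) \<partial>lborel) * g s"
      by (rule integral_mult_left_zero)
    finally show ?thesis
      by (simp only: mult.assoc[symmetric] integral_cexp_Icc(1)[OF pi(2), of w])
  qed simp
  have [measurable]: "(\<lambda>(s, r). indicator {..r} (\<pi> s) :: real) \<in> borel_measurable (M \<Otimes>\<^sub>M lborel)"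
    unfolding indicator_def by (simp add: atMost_iff case_prod_unfold) measurable
  have int: "integrable (M \<Otimes>\<^sub>M lborel) (\<lambda>(s, r). ?F s r)"
  proof (rule Bochner_Integration.integrable_bound)
    show "integrable (M \<Otimes>\<^sub>M lborel) (\<lambda>(s, r). g s * ?e r)"
    proof (rule Fubini_integrable)
      have "integrable M (\<lambda>s. norm (g s) * (\<integral>r. norm (?e r) \<partial>lborel))"
        using g by (intro integrable_mult_left) auto
      then show "integrable M (\<lambda>s. \<integral>r. norm (case (s, r) of (s, r) \<Rightarrow> g s * ?e r) \<partial>lborel)"
        by (simp only: prod.case norm_mult integral_mult_right_zero)
      show "AE s in M. integrable lborel (\<lambda>r. case (s, r) of (s, r) \<Rightarrow> g s * ?e r)"
        by (intro AE_I2) (simp only: prod.case, rule integrable_mult_right[OF e])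
    qed measurable
  qed (auto simp: norm_mult mult.commute split: split_indicator intro!: AE_I2)
  have "w * (\<integral>r. indicator {0..T} r *\<^sub>R (exp (- (w * of_real r)) * (\<integral>s. indicator {..r} (\<pi> s) *\<^sub>R g s \<partial>M)) \<partial>lborel)
      = w * (\<integral>r. \<integral>s. ?F s r \<partial>M \<partial>lborel)"
    by (intro arg_cong[where f="(*) w"] Bochner_Integration.integral_cong)
       (auto simp: algebra_simps simp flip: integral_mult_right_zero integral_scaleR_right)
  also have "\<dots> = w * (\<integral>s. \<integral>r. ?F s r \<partial>lborel \<partial>M)"
    using Fubini_integral[OF int] by simp
  also have "\<dots> = (\<integral>s. (exp (- (w * of_real (\<pi> s))) - exp (- (w * of_real T))) * g s \<partial>M)"
    by (subst integral_mult_right_zero[symmetric, of w]) (simp only: inner)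
  also have "\<dots> = (\<integral>s. exp (- (w * of_real (\<pi> s))) * g s \<partial>M) - exp (- (w * of_real T)) * (\<integral>s. g s \<partial>M)"
  proof -
    have "integrable M (\<lambda>s. exp (- (w * of_real (\<pi> s))) * g s)"
    proof (rule Bochner_Integration.integrable_bound)
      show "integrable M (\<lambda>s. exp (\<bar>Re w\<bar> * \<bar>T\<bar>) *\<^sub>R g s)" using g by auto
      have "norm (exp (- (w * of_real (\<pi> s))) * g s) \<le> norm (exp (\<bar>Re w\<bar> * \<bar>T\<bar>) *\<^sub>R g s)" for s
      proof (cases "g s = 0")
        case False
        then have pi: "0 \<le> \<pi> s" "\<pi> s \<le> T" using supp by auto
        have "- (Re w * \<pi> s) \<le> \<bar>Re w * \<pi> s\<bar>" by simp
        also have "\<dots> \<le> \<bar>Re w\<bar> * \<bar>T\<bar>" using pi by (auto simp: abs_mult intro: mult_left_mono)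
        finally show ?thesis by (simp add: norm_mult mult_right_mono)
      qed simp
      then show "AE s in M. norm (exp (- (w * of_real (\<pi> s))) * g s) \<le> norm (exp (\<bar>Re w\<bar> * \<bar>T\<bar>) *\<^sub>R g s)"
        by simp
    qed measurable
    then show ?thesis using g by (simp add: left_diff_distrib)
  qed
  finally show ?thesis by simp
qed

section \<open>Partial transforms and their growth\<close>

definition laplace_kernel :: "complex ^ 'n \<Rightarrow> real ^ 'n \<Rightarrow> complex" where
  "laplace_kernel z s = exp (- (\<Sum>i\<in>UNIV. z $ i * complex_of_real (s $ i)))"

definition vec_upd :: "'a ^ 'n \<Rightarrow> 'n \<Rightarrow> 'a \<Rightarrow> 'a ^ 'n" where
  "vec_upd x j a = (\<chi> i. if i = j then a else x $ i)"

definition zero_on :: "'n set \<Rightarrow> complex ^ 'n \<Rightarrow> complex ^ 'n" where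
  "zero_on S z = (\<chi> i. if i \<in> S then 0 else z $ i)"

lemma vec_upd_nth [simp]: "vec_upd x j a $ i = (if i = j then a else x $ i)"
  by (simp add: vec_upd_def)

lemma zero_on_nth [simp]: "zero_on S z $ i = (if i \<in> S then 0 else z $ i)"
  by (simp add: zero_on_def)

lemma laplace_kernel_prod: "laplace_kernel z s = (\<Prod>i\<in>UNIV. exp (- (z $ i * complex_of_real (s $ i))))"
  unfolding laplace_kernel_def by (simp add: exp_sum flip: sum_negf)

lemma laplace_kernel_0 [simp]: "laplace_kernel 0 s = 1"
  by (simp add: laplace_kernel_def)

lemma norm_laplace_kernel: "norm (laplace_kernel z s) = exp (- (\<Sum>i\<in>UNIV. Re (z $ i) * s $ i))"
  by (simp add: laplace_kernel_def)

lemma measurable_laplace_kernel [measurable]: "laplace_kernel z \<in> borel_measurable borel"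
  unfolding laplace_kernel_def[abs_def]
  by (intro borel_measurable_continuous_onI continuous_intros)

lemma norm_laplace_kernel_le_on_box:
  assumes "s \<in> {0..t}"
  shows "norm (laplace_kernel z s) \<le> exp (\<Sum>i\<in>UNIV. \<bar>Re (z $ i)\<bar> * t $ i)"
  unfolding norm_laplace_kernel exp_le_cancel_iff sum_negf[symmetric]
proof (rule sum_mono)
  fix i
  have "- (Re (z $ i) * s $ i) \<le> \<bar>Re (z $ i)\<bar> * s $ i"
    using assms abs_ge_minus_self[of "Re (z $ i) * s $ i"] by (auto simp: abs_mult less_eq_vec_def)
  also have "\<dots> \<le> \<bar>Re (z $ i)\<bar> * t $ i"
    using assms by (auto simp: less_eq_vec_def intro!: mult_left_mono)
  finally show "- (Re (z $ i) * s $ i) \<le> \<bar>Re (z $ i)\<bar> * t $ i" .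
qed

lemma measurable_vec_nth [measurable]: "(\<lambda>x :: real ^ 'n. x $ i) \<in> borel_measurable borel"
  by (intro borel_measurable_continuous_onI continuous_intros)

lemma measurable_box_indicator [measurable]:
  "(\<lambda>(r, s). indicator {0..r} (s :: real ^ 'n) :: real) \<in> borel_measurable (borel \<Otimes>\<^sub>M borel)"
  unfolding indicator_def by (simp add: less_eq_vec_def case_prod_unfold) measurable

lemma integral_laplace_kernel_box:
  assumes "s \<le> T"
  shows "(\<Prod>i\<in>UNIV. z $ i) * (\<integral>r. indicator {s..T} r *\<^sub>R laplace_kernel z r \<partial>lborel)
    = (\<Prod>i\<in>UNIV. exp (- (z $ i * of_real (s $ i))) - exp (- (z $ i * of_real (T $ i))))"
    and "integrable lborel (\<lambda>r. indicator {s..T} r *\<^sub>R laplace_kernel z r)"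
proof -
  have le: "s $ i \<le> T $ i" for i using assms by (simp add: less_eq_vec_def)
  have eq: "indicator {s..T} r *\<^sub>R laplace_kernel z r
      = (\<Prod>i\<in>UNIV. indicator {s $ i..T $ i} (r $ i) *\<^sub>R exp (- (z $ i * of_real (r $ i))))" for r
  proof (cases "r \<in> {s..T}")
    case True
    then show ?thesis by (auto simp: laplace_kernel_prod less_eq_vec_def intro!: prod.cong)
  next
    case False
    then obtain i where "r $ i \<notin> {s $ i..T $ i}" by (auto simp: less_eq_vec_def)
    then have "\<exists>i. indicator {s $ i..T $ i} (r $ i) *\<^sub>R exp (- (z $ i * of_real (r $ i))) = 0"
      by (intro exI[of _ i]) simp
    then show ?thesis using False by (simp add: prod_zero_iff)
  qed
  note I = integral_cexp_Icc[OF le]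
  show "integrable lborel (\<lambda>r. indicator {s..T} r *\<^sub>R laplace_kernel z r)"
    unfolding eq by (rule integrable_vec_prod[OF I(2)])
  show "(\<Prod>i\<in>UNIV. z $ i) * (\<integral>r. indicator {s..T} r *\<^sub>R laplace_kernel z r \<partial>lborel)
    = (\<Prod>i\<in>UNIV. exp (- (z $ i * of_real (s $ i))) - exp (- (z $ i * of_real (T $ i))))"
    unfolding eq integral_vec_prod[OF I(2)] prod.distrib[symmetric] I(1) ..
qed

lemma integrable_exp_decay:
  assumes "0 < (d::real)"
  shows "integrable lborel (\<lambda>x. indicator {0..} x * exp (- (d * x)))"
proof -
  have "((\<lambda>x. exp (- d * x)) has_integral exp (- d * 0) / d) {0..}"
    using assms by (intro has_integral_exp_minus_to_infinity) auto
  then have "(\<lambda>x. exp (- d * x)) absolutely_integrable_on {0..}"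
    by (intro nonnegative_absolutely_integrable_1) (auto simp: integrable_on_def)
  then have "integrable lebesgue (\<lambda>x. indicator {0..} x * exp (- (d * x)))"
    by (simp add: set_integrable_def)
  then show ?thesis
    by (subst (asm) integrable_completion) auto
qed

context
  fixes f :: "real ^ 'n \<Rightarrow> complex"
  assumes f_borel [measurable]: "f \<in> borel_measurable borel"
    and f_int: "\<And>t. integrable lborel (\<lambda>s. indicator {0..t} s *\<^sub>R f s)"
begin

lemma multi_laplace_partial_lborel:
  "multi_laplace_partial f z t = (\<integral>s. indicator {0..t} s *\<^sub>R (laplace_kernel z s * f s) \<partial>lborel)"
  unfolding multi_laplace_partial_def set_lebesgue_integral_def laplace_kernel_def[symmetric]
  by (rule integral_completion) measurable

lemma integrable_laplace_kernel_box:
  "integrable lborel (\<lambda>s. indicator {0..t} s *\<^sub>R (laplace_kernel z s * f s))"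
proof (rule Bochner_Integration.integrable_bound)
  show "integrable lborel (\<lambda>s. exp (\<Sum>i\<in>UNIV. \<bar>Re (z $ i)\<bar> * t $ i) *\<^sub>R (indicator {0..t} s *\<^sub>R f s))"
    by (intro integrable_scaleR_right f_int)
  show "AE s in lborel. norm (indicator {0..t} s *\<^sub>R (laplace_kernel z s * f s))
      \<le> norm (exp (\<Sum>i\<in>UNIV. \<bar>Re (z $ i)\<bar> * t $ i) *\<^sub>R (indicator {0..t} s *\<^sub>R f s))"
    using norm_laplace_kernel_le_on_box[of _ t z]
    by (intro AE_I2) (auto simp: norm_mult split: split_indicator intro!: mult_right_mono)
qed measurable

lemma measurable_multi_laplace_partial [measurable]:
  "multi_laplace_partial f z \<in> borel_measurable borel"
  unfolding multi_laplace_partial_lborel[abs_def]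
  by measurable

text \<open>
  Integration by parts in the coordinate \<open>j\<close>: truncating the box \<open>[0,t]\<close> by
  \<open>s\<^sub>j \<le> r\<close> gives the box whose corner has \<open>r\<close> as its coordinate \<open>j\<close>.
\<close>

lemma multi_laplace_partial_vec_upd:
  fixes z :: "complex ^ 'n" and t :: "real ^ 'n" and a :: complex and j :: 'n
  assumes "0 \<le> t"
  defines "w \<equiv> a - z $ j"
  shows "multi_laplace_partial f (vec_upd z j a) t
    = exp (- (w * of_real (t $ j))) * multi_laplace_partial f z t
      + w * (\<integral>r. indicator {0..t $ j} r *\<^sub>R
          (exp (- (w * of_real r)) * multi_laplace_partial f z (vec_upd t j r)) \<partial>lborel)"
proof -
  let ?g = "\<lambda>s. indicator {0..t} s *\<^sub>R (laplace_kernel z s * f s)"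
  have ker: "laplace_kernel (vec_upd z j a) s = exp (- (w * of_real (s $ j))) * laplace_kernel z s" for s
  proof -
    have "(\<Sum>i\<in>UNIV. vec_upd z j a $ i * of_real (s $ i))
        = (\<Sum>i\<in>UNIV. z $ i * of_real (s $ i) + (if i = j then w * of_real (s $ j) else 0))"
      by (intro sum.cong) (auto simp: w_def algebra_simps)
    also have "\<dots> = (\<Sum>i\<in>UNIV. z $ i * of_real (s $ i)) + w * of_real (s $ j)"
      by (simp add: sum.distrib)
    finally show ?thesis
      by (simp add: laplace_kernel_def exp_diff exp_minus field_simps)
  qed
  have ind: "indicator {..r} (s $ j) *\<^sub>R ?g s
      = indicator {0..vec_upd t j r} s *\<^sub>R (laplace_kernel z s * f s)" if "r \<in> {0..t $ j}" for r s
  proof -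
    have "s \<in> {0..vec_upd t j r} \<longleftrightarrow> s \<in> {0..t} \<and> s $ j \<le> r"
      using that by (auto simp: less_eq_vec_def)
    then show ?thesis
      by (auto simp: indicator_def)
  qed
  have "multi_laplace_partial f (vec_upd z j a) t = (\<integral>s. exp (- (w * of_real (s $ j))) * ?g s \<partial>lborel)"
    unfolding multi_laplace_partial_lborel ker by (intro Bochner_Integration.integral_cong) auto
  also have "\<dots> = exp (- (w * of_real (t $ j))) * (\<integral>s. ?g s \<partial>lborel)
      + w * (\<integral>r. indicator {0..t $ j} r *\<^sub>R (exp (- (w * of_real r)) *
          (\<integral>s. indicator {..r} (s $ j) *\<^sub>R ?g s \<partial>lborel)) \<partial>lborel)"
    by (rule integral_cexp_by_parts[OF sigma_finite_lborel integrable_laplace_kernel_box])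
       (auto simp: less_eq_vec_def indicator_def split: if_splits)
  also have "(\<integral>r. indicator {0..t $ j} r *\<^sub>R (exp (- (w * of_real r)) *
          (\<integral>s. indicator {..r} (s $ j) *\<^sub>R ?g s \<partial>lborel)) \<partial>lborel)
      = (\<integral>r. indicator {0..t $ j} r *\<^sub>R
          (exp (- (w * of_real r)) * multi_laplace_partial f z (vec_upd t j r)) \<partial>lborel)"
  proof (rule Bochner_Integration.integral_cong[OF refl])
    fix r
    show "indicator {0..t $ j} r *\<^sub>R (exp (- (w * of_real r)) * (\<integral>s. indicator {..r} (s $ j) *\<^sub>R ?g s \<partial>lborel))
      = indicator {0..t $ j} r *\<^sub>R (exp (- (w * of_real r)) * multi_laplace_partial f z (vec_upd t j r))"
    proof (cases "r \<in> {0..t $ j}")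
      case True
      then show ?thesis by (simp only: multi_laplace_partial_lborel ind)
    next
      case False
      then have "indicator {0..t $ j} r = (0 :: real)" by (simp only: indicator_simps not_False_eq_True)
      then show ?thesis by (simp only: scaleR_zero_left)
    qed
  qed
  finally show ?thesis
    by (simp only: multi_laplace_partial_lborel)
qed

text \<open>
  The exponents \<open>b\<^sub>j\<close> with \<open>j \<in> S\<close> are removed one after the other. Each removal is an
  integration by parts with \<open>w = - b\<^sub>j\<close>, and its two terms are bounded by
  \<open>exp(b\<^sub>j t\<^sub>j)\<close> and by the integral of \<open>b\<^sub>j exp(b\<^sub>j r)\<close> over \<open>0 \<le> r \<le> t\<^sub>j\<close>, again at most \<open>exp(b\<^sub>j t\<^sub>j)\<close>, times the
  previous bound, which does not involve the coordinate \<open>j\<close>. This is where \<open>b\<^sub>j \<ge> 0\<close> is used.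
\<close>

lemma norm_multi_laplace_partial_zero_on_le:
  assumes b: "\<And>j. j \<in> S \<Longrightarrow> z $ j = of_real (b j)" "\<And>j. j \<in> S \<Longrightarrow> 0 \<le> b j"
    and C: "\<And>t. 0 \<le> t \<Longrightarrow> norm (multi_laplace_partial f z t) \<le> C"
    and "0 \<le> t"
  shows "norm (multi_laplace_partial f (zero_on S z) t) \<le> 2 ^ card S * C * exp (\<Sum>j\<in>S. b j * t $ j)"
proof -
  have "finite S" by simp
  then show ?thesis using b \<open>0 \<le> t\<close>
  proof (induction S arbitrary: t)
    case empty
    have "zero_on {} z = z" by (simp add: vec_eq_iff)
    then show ?case using C empty by simp
  next
    case (insert j S)
    define B where "B = 2 ^ card S * C * exp (\<Sum>i\<in>S. b i * t $ i)"
    have C0: "0 \<le> C" using C[of 0] norm_ge_zero order_trans by blast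
    have bj: "0 \<le> b j" "0 \<le> t $ j" using insert.prems by (auto simp: less_eq_vec_def)
    have B0: "0 \<le> B" using C0 by (simp add: B_def)
    have le_B: "norm (multi_laplace_partial f (zero_on S z) (vec_upd t j r)) \<le> B" if "0 \<le> r" for r
    proof -
      have "0 \<le> vec_upd t j r" using insert.prems that by (auto simp: less_eq_vec_def)
      moreover have "(\<Sum>i\<in>S. b i * vec_upd t j r $ i) = (\<Sum>i\<in>S. b i * t $ i)"
        using insert.hyps by (intro sum.cong) auto
      ultimately show ?thesis
        using insert.IH[of "vec_upd t j r"] insert.prems by (simp add: B_def)
    qed
    have expint: "b j * (\<integral>r. indicator {0..t $ j} r * exp (b j * r) \<partial>lborel) = exp (b j * t $ j) - 1"
    proof -
      have "complex_of_real (b j * (\<integral>r. indicator {0..t $ j} r * exp (b j * r) \<partial>lborel))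
          = of_real (b j) * (\<integral>r. of_real (indicator {0..t $ j} r * exp (b j * r)) \<partial>lborel)"
        unfolding of_real_mult[of "b j"] by (subst integral_complex_of_real) (rule refl)
      also have "(\<integral>r. complex_of_real (indicator {0..t $ j} r * exp (b j * r)) \<partial>lborel)
          = (\<integral>r. indicator {0..t $ j} r *\<^sub>R exp (- (- of_real (b j) * of_real r)) \<partial>lborel)"
        by (intro Bochner_Integration.integral_cong) (auto split: split_indicator simp flip: exp_of_real)
      also have "of_real (b j) * \<dots> = of_real (exp (b j * t $ j) - 1)"
        using integral_cexp_Icc(1)[OF bj(2), of "- of_real (b j)"]
          by (simp flip: exp_of_real) (metis minus_diff_eq minus_equation_iff)
      finally show ?thesis by (simp only: of_real_eq_iff)
    qed
    have zo: "zero_on (insert j S) z = vec_upd (zero_on S z) j 0"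
      by (simp add: vec_eq_iff)
    have zj: "zero_on S z $ j = of_real (b j)"
      using insert by simp
    have tj: "vec_upd t j (t $ j) = t" by (simp add: vec_eq_iff)
    let ?I = "\<integral>r. indicator {0..t $ j} r *\<^sub>R
          (exp (of_real (b j) * of_real r) * multi_laplace_partial f (zero_on S z) (vec_upd t j r)) \<partial>lborel"
    have "norm ?I \<le> (\<integral>r. norm (indicator {0..t $ j} r *\<^sub>R
          (exp (of_real (b j) * of_real r) * multi_laplace_partial f (zero_on S z) (vec_upd t j r))) \<partial>lborel)"
      by (rule integral_norm_bound)
    also have "\<dots> \<le> (\<integral>r. B * (indicator {0..t $ j} r * exp (b j * r)) \<partial>lborel)"
    proof (rule integral_mono')
      have "integrable lborel (\<lambda>r. indicator {0..t $ j} r *\<^sub>R exp (b j * r))"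
        by (intro borel_integrable_compact continuous_intros) auto
      then show "integrable lborel (\<lambda>r. B * (indicator {0..t $ j} r * exp (b j * r)))"
        by (intro integrable_mult_right) simp
      show "norm (indicator {0..t $ j} r *\<^sub>R (exp (of_real (b j) * of_real r) *
          multi_laplace_partial f (zero_on S z) (vec_upd t j r)))
        \<le> B * (indicator {0..t $ j} r * exp (b j * r))" for r
        using le_B[of r] by (auto simp: norm_mult mult.commute[of B] split: split_indicator intro!: mult_left_mono)
      show "0 \<le> B * (indicator {0..t $ j} r * exp (b j * r))" for r
        using B0 by simp
    qed
    finally have I: "norm ?I \<le> B * (\<integral>r. indicator {0..t $ j} r * exp (b j * r) \<partial>lborel)"
      by simp
    have "multi_laplace_partial f (zero_on (insert j S) z) t
        = exp (of_real (b j) * of_real (t $ j)) * multi_laplace_partial f (zero_on S z) t - of_real (b j) * ?I"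
      unfolding zo by (subst multi_laplace_partial_vec_upd) (use insert.prems zj in auto)
    also have "norm \<dots> \<le> exp (b j * t $ j) * norm (multi_laplace_partial f (zero_on S z) t) + b j * norm ?I"
      using bj by (intro order_trans[OF norm_triangle_ineq4]) (simp add: norm_mult)
    also have "\<dots> \<le> exp (b j * t $ j) * B + b j * (B * (\<integral>r. indicator {0..t $ j} r * exp (b j * r) \<partial>lborel))"
      using le_B[OF bj(2)] I bj unfolding tj by (intro add_mono mult_left_mono) auto
    also have "\<dots> = exp (b j * t $ j) * B + B * (exp (b j * t $ j) - 1)"
      by (simp add: expint[symmetric])
    also have "\<dots> \<le> 2 * B * exp (b j * t $ j)"
      using B0 by (simp add: algebra_simps)
    also have "\<dots> = 2 ^ card (insert j S) * C * exp (\<Sum>i\<in>insert j S. b i * t $ i)"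
      using insert.hyps by (simp add: B_def exp_add)
    finally show ?case .
  qed
qed

section \<open>The transform of the primitive\<close>

text \<open>
  Exchanging the integrations over \<open>0 \<le> s \<le> r \<le> T\<close> leaves \<open>f(s)\<close> against
  \<open>\<Prod>\<^sub>j (exp(- z\<^sub>j s\<^sub>j) - exp(- z\<^sub>j T\<^sub>j))\<close>; the sum over \<open>S\<close> is the expansion of this
  product. The summand \<open>S = {}\<close> is the partial transform at \<open>z\<close>, the others are boundary terms.
\<close>

lemma integral_laplace_kernel_primitive:
  fixes z :: "complex ^ 'n"
  assumes T: "0 \<le> T"
  shows "(\<Prod>i\<in>UNIV. z $ i) *
      (\<integral>r. indicator {0..T} r *\<^sub>R (laplace_kernel z r * multi_laplace_partial f 0 r) \<partial>lborel)
    = (\<Sum>S\<in>Pow UNIV. (\<Prod>j\<in>S. - exp (- (z $ j * of_real (T $ j)))) * multi_laplace_partial f (zero_on S z) T)"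
proof -
  let ?k = "\<lambda>r. indicator {0..T} r *\<^sub>R laplace_kernel z r"
  let ?h = "\<lambda>s. indicator {0..T} s *\<^sub>R f s"
  let ?F = "\<lambda>r s. indicator {0..r} s *\<^sub>R (?k r * ?h s)"
  have k: "integrable lborel ?k" by (rule integral_laplace_kernel_box[OF T])
  have int: "integrable (lborel \<Otimes>\<^sub>M lborel) (\<lambda>(r, s). ?F r s)"
  proof (rule Bochner_Integration.integrable_bound)
    show "integrable (lborel \<Otimes>\<^sub>M lborel) (\<lambda>(r, s). ?k r * ?h s)"
    proof (rule lborel_pair.Fubini_integrable)
      have "integrable lborel (\<lambda>r. norm (?k r) * (\<integral>s. norm (?h s) \<partial>lborel))"
        using k by (intro integrable_mult_left integrable_norm)
      then show "integrable lborel (\<lambda>r. \<integral>s. norm (case (r, s) of (r, s) \<Rightarrow> ?k r * ?h s) \<partial>lborel)"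
        by (simp only: prod.case norm_mult integral_mult_right_zero)
      show "AE r in lborel. integrable lborel (\<lambda>s. case (r, s) of (r, s) \<Rightarrow> ?k r * ?h s)"
        by (intro AE_I2) (simp only: prod.case, rule integrable_mult_right[OF f_int])
    qed measurable
  qed (auto split: split_indicator intro!: AE_I2)
  have inner_s: "(\<integral>s. ?F r s \<partial>lborel) = indicator {0..T} r *\<^sub>R (laplace_kernel z r * multi_laplace_partial f 0 r)" for r
  proof -
    have "(\<integral>s. ?F r s \<partial>lborel) = (\<integral>s. ?k r * (indicator {0..r} s *\<^sub>R f s) \<partial>lborel)"
      by (intro Bochner_Integration.integral_cong) (auto intro: order_trans split: split_indicator)
    also have "\<dots> = ?k r * (\<integral>s. indicator {0..r} s *\<^sub>R f s \<partial>lborel)"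
      by (rule integral_mult_right_zero)
    finally show ?thesis
      by (simp add: multi_laplace_partial_lborel)
  qed
  have inner_r: "(\<Prod>i\<in>UNIV. z $ i) * (\<integral>r. ?F r s \<partial>lborel)
      = (\<Sum>S\<in>Pow UNIV. (\<Prod>j\<in>S. - exp (- (z $ j * of_real (T $ j)))) *
          (indicator {0..T} s *\<^sub>R (laplace_kernel (zero_on S z) s * f s)))" for s
  proof (cases "s \<in> {0..T}")
    case True
    have "(\<integral>r. ?F r s \<partial>lborel) = (\<integral>r. (indicator {s..T} r *\<^sub>R laplace_kernel z r) * f s \<partial>lborel)"
      using True by (intro Bochner_Integration.integral_cong) (auto intro: order_trans split: split_indicator)
    also have "\<dots> = (\<integral>r. indicator {s..T} r *\<^sub>R laplace_kernel z r \<partial>lborel) * f s"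
      by (rule integral_mult_left_zero)
    also have "(\<Prod>i\<in>UNIV. z $ i) * \<dots>
        = (\<Prod>i\<in>UNIV. - exp (- (z $ i * of_real (T $ i))) + exp (- (z $ i * of_real (s $ i)))) * f s"
      using True integral_laplace_kernel_box(1)[of s T z] by (simp flip: mult.assoc)
    also have "(\<Prod>i\<in>UNIV. - exp (- (z $ i * of_real (T $ i))) + exp (- (z $ i * of_real (s $ i))))
        = (\<Sum>S\<in>Pow UNIV. (\<Prod>j\<in>S. - exp (- (z $ j * of_real (T $ j)))) * laplace_kernel (zero_on S z) s)"
    proof (subst prod_add, simp, intro sum.cong refl arg_cong2[where f="(*)"])
      fix S :: "'n set"
      show "(\<Prod>i\<in>UNIV - S. exp (- (z $ i * of_real (s $ i)))) = laplace_kernel (zero_on S z) s"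
        unfolding laplace_kernel_prod by (rule prod.mono_neutral_cong_left) auto
    qed
    finally show ?thesis using True by (simp add: sum_distrib_right mult.assoc)
  qed simp
  have "(\<Prod>i\<in>UNIV. z $ i) *
      (\<integral>r. indicator {0..T} r *\<^sub>R (laplace_kernel z r * multi_laplace_partial f 0 r) \<partial>lborel)
      = (\<Prod>i\<in>UNIV. z $ i) * (\<integral>r. \<integral>s. ?F r s \<partial>lborel \<partial>lborel)"
    by (simp only: inner_s)
  also have "\<dots> = (\<Prod>i\<in>UNIV. z $ i) * (\<integral>s. \<integral>r. ?F r s \<partial>lborel \<partial>lborel)"
    using lborel_pair.Fubini_integral[OF int] by simp
  also have "\<dots> = (\<integral>s. (\<Sum>S\<in>Pow UNIV. (\<Prod>j\<in>S. - exp (- (z $ j * of_real (T $ j)))) *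
          (indicator {0..T} s *\<^sub>R (laplace_kernel (zero_on S z) s * f s))) \<partial>lborel)"
    by (subst integral_mult_right_zero[symmetric]) (simp only: inner_r)
  also have "\<dots> = (\<Sum>S\<in>Pow UNIV. (\<Prod>j\<in>S. - exp (- (z $ j * of_real (T $ j)))) * multi_laplace_partial f (zero_on S z) T)"
    unfolding multi_laplace_partial_lborel
    by (subst Bochner_Integration.integral_sum)
       (intro integrable_mult_right integrable_laplace_kernel_box,
        simp only: integral_mult_right_zero)
  finally show ?thesis .
qed

context
  fixes \<omega> :: "'n \<Rightarrow> real"
  assumes \<omega>_nonneg: "\<And>j. 0 \<le> \<omega> j"
    and Omega_b: "\<And>z. (\<And>j. \<omega> j < Re (z $ j)) \<Longrightarrow> z \<in> laplace_Omega_b f"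
begin

text \<open>
  The base point is \<open>z\<close> with the coordinates in \<open>S\<close> replaced by the real numbers
  \<open>b\<^sub>j\<close>: its partial transforms are bounded, and replacing these coordinates by \<open>0\<close>
  costs a factor of at most \<open>2 exp(b\<^sub>j t\<^sub>j)\<close> each. For \<open>S = UNIV\<close> this is the growth of the primitive.
\<close>

lemma partial_zero_on_growth:
  assumes z: "\<And>j. \<omega> j < Re (z $ j)" and b: "\<And>j. \<omega> j < b j"
  obtains C where "\<And>t. 0 \<le> t \<Longrightarrow>
    norm (multi_laplace_partial f (zero_on S z) t) \<le> C * exp (\<Sum>j\<in>S. b j * t $ j)"
proof -
  define y :: "complex ^ 'n" where "y = (\<chi> j. if j \<in> S then of_real (b j) else z $ j)"
  have "y \<in> laplace_Omega_b f"
    using z b by (intro Omega_b) (auto simp: y_def)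
  then obtain C where C: "\<And>t. 0 \<le> t \<Longrightarrow> norm (multi_laplace_partial f y t) \<le> C"
    unfolding laplace_Omega_b_def bounded_iff by blast
  have zo: "zero_on S z = zero_on S y" by (simp add: vec_eq_iff y_def)
  have b0: "0 \<le> b j" for j using b[of j] \<omega>_nonneg[of j] by simp
  show thesis
  proof (rule that)
    show "norm (multi_laplace_partial f (zero_on S z) t) \<le> 2 ^ card S * C * exp (\<Sum>j\<in>S. b j * t $ j)"
      if "0 \<le> t" for t
      unfolding zo
      by (rule norm_multi_laplace_partial_zero_on_le[OF _ b0 C that])
         (simp_all add: y_def)
  qed
qed

lemma integrable_laplace_kernel_primitive:
  assumes z: "\<And>j. \<omega> j < Re (z $ j)"
  shows "integrable lborel (\<lambda>r. indicator {0..} r *\<^sub>R (laplace_kernel z r * multi_laplace_partial f 0 r))"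
proof -
  define b where "b j = (\<omega> j + Re (z $ j)) / 2" for j
  have b: "\<omega> j < b j" "b j < Re (z $ j)" for j using z[of j] by (simp_all add: b_def)
  obtain C where C: "\<And>t. 0 \<le> t \<Longrightarrow>
    norm (multi_laplace_partial f (zero_on UNIV z) t) \<le> C * exp (\<Sum>j\<in>UNIV. b j * t $ j)"
    using partial_zero_on_growth[of z b UNIV, OF z b(1)] by blast
  have zo: "zero_on UNIV z = 0" by (simp add: vec_eq_iff)
  let ?d = "\<lambda>i x. complex_of_real (indicator {0..} x * exp (- ((Re (z $ i) - b i) * x)))"
  have "integrable lborel (\<lambda>r. of_real C * (\<Prod>i\<in>UNIV. ?d i (r $ i)))"
    using b by (intro integrable_mult_right integrable_vec_prod integrable_of_real integrable_exp_decay) simp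
  then show ?thesis
  proof (rule Bochner_Integration.integrable_bound)
    have "norm (indicator {0..} r *\<^sub>R (laplace_kernel z r * multi_laplace_partial f 0 r))
        \<le> norm (of_real C * (\<Prod>i\<in>UNIV. ?d i (r $ i)))" for r
    proof (cases "0 \<le> r")
      case True
      then have ri: "0 \<le> r $ i" for i by (simp add: less_eq_vec_def)
      have "norm (laplace_kernel z r * multi_laplace_partial f 0 r)
          \<le> exp (- (\<Sum>i\<in>UNIV. Re (z $ i) * r $ i)) * (C * exp (\<Sum>i\<in>UNIV. b i * r $ i))"
        using C[OF True] by (simp add: norm_mult norm_laplace_kernel zo)
      also have "\<dots> = C * exp (\<Sum>i\<in>UNIV. - ((Re (z $ i) - b i) * r $ i))"
        by (simp add: exp_minus exp_diff sum_subtractf left_diff_distrib field_simps)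
      also have "\<dots> \<le> norm (of_real C * (\<Prod>i\<in>UNIV. ?d i (r $ i)))"
        using ri by (simp add: norm_mult prod_norm[symmetric] exp_sum mult_right_mono prod_nonneg)
      finally show ?thesis using True by simp
    qed simp
    then show "AE r in lborel. norm (indicator {0..} r *\<^sub>R (laplace_kernel z r * multi_laplace_partial f 0 r))
        \<le> norm (of_real C * (\<Prod>i\<in>UNIV. ?d i (r $ i)))" by simp
  qed measurable
qed

text \<open>
  In \<open>integral_laplace_kernel_primitive\<close> the corner \<open>T\<close> tends to infinity along the diagonal.
  By the growth bound with exponents \<open>b\<^sub>j < Re z\<^sub>j\<close>, every boundary term decays exponentially.
\<close>

lemma laplace_transform_primitive:
  assumes z: "\<And>j. \<omega> j < Re (z $ j)" and L: "has_multi_laplace f z L"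
  shows "(\<Prod>i\<in>UNIV. z $ i) *
    (\<integral>r. indicator {0..} r *\<^sub>R (laplace_kernel z r * multi_laplace_partial f 0 r) \<partial>lborel) = L"
proof -
  define T :: "nat \<Rightarrow> real ^ 'n" where "T N = (\<chi> i. real N)" for N
  have T0: "0 \<le> T N" for N by (simp add: T_def less_eq_vec_def)
  have T_top: "filterlim T at_top sequentially"
    unfolding filterlim_iff eventually_at_top_vec
  proof safe
    fix P :: "real ^ 'n \<Rightarrow> bool" and a :: real assume P: "\<forall>t. (\<forall>i. a \<le> t $ i) \<longrightarrow> P t"
    have "eventually (\<lambda>N. a \<le> real N) sequentially"
      by (metis eventually_sequentiallyI nat_ceiling_le_eq)
    then show "eventually (\<lambda>N. P (T N)) sequentially"
      by eventually_elim (use P in \<open>auto simp: T_def\<close>)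
  qed
  let ?P = "\<lambda>r. laplace_kernel z r * multi_laplace_partial f 0 r"
  have dom: "(\<lambda>N. \<integral>r. indicator {0..T N} r *\<^sub>R ?P r \<partial>lborel) \<longlonglongrightarrow> (\<integral>r. indicator {0..} r *\<^sub>R ?P r \<partial>lborel)"
  proof (rule integral_dominated_convergence)
    show "integrable lborel (\<lambda>r. norm (indicator {0..} r *\<^sub>R ?P r))"
      by (intro integrable_norm integrable_laplace_kernel_primitive z)
    show "AE r in lborel. (\<lambda>N. indicator {0..T N} r *\<^sub>R ?P r) \<longlonglongrightarrow> indicator {0..} r *\<^sub>R ?P r"
    proof (intro AE_I2 tendsto_eventually)
      fix r :: "real ^ 'n"
      obtain M where M: "norm r \<le> real M" using real_arch_simple by blast
      have "r \<le> T N" if "N \<ge> M" for N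
      proof -
        have "r $ i \<le> real N" for i
          using M that component_le_norm_cart[of r i] by linarith
        then show ?thesis by (simp add: T_def less_eq_vec_def)
      qed
      then have "eventually (\<lambda>N. r \<le> T N) sequentially"
        by (auto simp: eventually_sequentially)
      then show "eventually (\<lambda>N. indicator {0..T N} r *\<^sub>R ?P r = indicator {0..} r *\<^sub>R ?P r) sequentially"
        by eventually_elim (auto split: split_indicator)
    qed
    show "AE r in lborel. norm (indicator {0..T N} r *\<^sub>R ?P r) \<le> norm (indicator {0..} r *\<^sub>R ?P r)" for N
      by (intro AE_I2) (auto split: split_indicator)
  qed measurable
  \<comment> \<open>The factors \<open>exp(- z\<^sub>j T\<^sub>j)\<close> outweigh the growth \<open>exp(b\<^sub>j T\<^sub>j)\<close> of the partial
    transform as soon as \<open>S\<close> is nonempty.\<close>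
  have term_lim: "(\<lambda>N. (\<Prod>j\<in>S. - exp (- (z $ j * of_real (T N $ j)))) * multi_laplace_partial f (zero_on S z) (T N))
      \<longlonglongrightarrow> (if S = {} then L else 0)" for S
  proof (cases "S = {}")
    case True
    have "zero_on {} z = z" by (simp add: vec_eq_iff)
    then show ?thesis
      using filterlim_compose[OF L[unfolded has_multi_laplace_def] T_top] True by simp
  next
    case False
    define b where "b j = (\<omega> j + Re (z $ j)) / 2" for j
    have b: "\<omega> j < b j" "b j < Re (z $ j)" for j using z[of j] by (simp_all add: b_def)
    obtain C where C: "\<And>t. 0 \<le> t \<Longrightarrow>
      norm (multi_laplace_partial f (zero_on S z) t) \<le> C * exp (\<Sum>j\<in>S. b j * t $ j)"
      using partial_zero_on_growth[of z b S, OF z b(1)] by blast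
    define d where "d = (\<Sum>j\<in>S. Re (z $ j) - b j)"
    have d: "0 < d" unfolding d_def using b False by (intro sum_pos) auto
    have le: "norm ((\<Prod>j\<in>S. - exp (- (z $ j * of_real (T N $ j)))) * multi_laplace_partial f (zero_on S z) (T N))
        \<le> C * exp (- (d * real N))" for N
    proof -
      have "norm ((\<Prod>j\<in>S. - exp (- (z $ j * of_real (T N $ j)))) * multi_laplace_partial f (zero_on S z) (T N))
          = exp (- (\<Sum>j\<in>S. Re (z $ j)) * real N) * norm (multi_laplace_partial f (zero_on S z) (T N))"
        by (simp add: norm_mult prod_norm[symmetric] T_def exp_sum sum_distrib_right flip: sum_negf)
      also have "\<dots> \<le> exp (- (\<Sum>j\<in>S. Re (z $ j)) * real N) * (C * exp (\<Sum>j\<in>S. b j * T N $ j))"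
        by (intro mult_left_mono C T0) auto
      also have "\<dots> = C * exp (- (d * real N))"
      proof -
        have "(\<Sum>j\<in>S. b j * T N $ j) = (\<Sum>j\<in>S. b j) * real N"
          by (simp add: T_def sum_distrib_right)
        then show ?thesis
          by (simp add: d_def sum_subtractf left_diff_distrib exp_diff exp_minus field_simps)
      qed
      finally show ?thesis .
    qed
    have "(\<lambda>N. C * exp (- (d * real N))) \<longlonglongrightarrow> C * 0"
      by (intro tendsto_mult_left filterlim_compose[OF exp_at_bot] filterlim_uminus_at_bot_at_top[THEN filterlim_compose]
            filterlim_tendsto_pos_mult_at_top[OF tendsto_const d] filterlim_real_sequentially)
    then show ?thesis
      using False Lim_null_comparison[OF always_eventually[OF allI[OF le]]] by simp
  qed
  have "(\<lambda>N. \<Sum>S\<in>Pow UNIV. (\<Prod>j\<in>S. - exp (- (z $ j * of_real (T N $ j)))) * multi_laplace_partial f (zero_on S z) (T N))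
      \<longlonglongrightarrow> (\<Sum>S\<in>Pow (UNIV::'n set). if S = {} then L else 0)"
    by (intro tendsto_sum term_lim)
  also have "(\<Sum>S\<in>Pow (UNIV::'n set). if S = {} then L else 0) = L"
    by simp
  finally have "(\<lambda>N. (\<Prod>i\<in>UNIV. z $ i) * (\<integral>r. indicator {0..T N} r *\<^sub>R ?P r \<partial>lborel)) \<longlonglongrightarrow> L"
    unfolding integral_laplace_kernel_primitive[OF T0] .
  then show ?thesis
    using tendsto_mult_left[OF dom] LIMSEQ_unique by blast
qed

end

end

section \<open>Uniqueness on a product grid for absolutely convergent transforms\<close>

lemma laplace_partial_lborel:
  assumes [measurable]: "h \<in> borel_measurable borel"
  shows "laplace_partial h z t = (\<integral>s. indicator {0..t} s *\<^sub>R (exp (- (z * of_real s)) * h s) \<partial>lborel)"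
  unfolding laplace_partial_def set_lebesgue_integral_def
  by (rule integral_completion) measurable

lemma has_laplace_integral:
  assumes [measurable]: "h \<in> borel_measurable borel" and neg: "\<And>y. y < 0 \<Longrightarrow> h y = 0"
    and int: "integrable lborel (\<lambda>y. exp (- (z * of_real y)) * h y)"
  shows "has_laplace h z (\<integral>y. exp (- (z * of_real y)) * h y \<partial>lborel)"
proof -
  have "laplace_partial h z = (\<lambda>t. \<integral>y. indicator {..t} y *\<^sub>R (exp (- (z * of_real y)) * h y) \<partial>lborel)"
  proof
    fix t
    show "laplace_partial h z t = (\<integral>y. indicator {..t} y *\<^sub>R (exp (- (z * of_real y)) * h y) \<partial>lborel)"
      unfolding laplace_partial_lborel[OF assms(1)]
    proof (intro Bochner_Integration.integral_cong refl)
      fix y show "indicator {0..t} y *\<^sub>R (exp (- (z * of_real y)) * h y)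
          = indicator {..t} y *\<^sub>R (exp (- (z * of_real y)) * h y)"
        using neg[of y] by (cases "y < 0") (auto simp: indicator_def)
    qed
  qed
  then show ?thesis
    unfolding has_laplace_def using tendsto_integral_at_top[OF _ int] by simp
qed

text \<open>
  One-dimensional uniqueness for a function with absolutely convergent transform. Convergence at
  the points \<open>w + 1/(n+1)\<close> is enough to bound the abscissa by \<open>w\<close>; a countable family of
  conditions is what Fubini's theorem can supply simultaneously for almost every slice.
\<close>

lemma laplace_uniqueness_AE:
  fixes \<mu> :: "nat \<Rightarrow> complex" and w :: real
  assumes uniq: "laplace_uniqueness_seq \<mu>" and w: "\<And>k. w < Re (\<mu> k)"
    and [measurable]: "h \<in> borel_measurable borel" and neg: "\<And>y. y < 0 \<Longrightarrow> h y = 0"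
    and int: "\<And>n::nat. integrable lborel (\<lambda>y. exp (- (of_real (w + 1 / Suc n) * of_real y)) * h y)"
    and zero: "\<And>k. integrable lborel (\<lambda>y. exp (- (\<mu> k * of_real y)) * h y)"
      "\<And>k. (\<integral>y. exp (- (\<mu> k * of_real y)) * h y \<partial>lborel) = 0"
  shows "AE y in lborel. h y = 0"
proof -
  have "loc_integrable h"
    unfolding loc_integrable_def
  proof
    fix T :: real
    let ?c = "exp (\<bar>w + 1\<bar> * \<bar>T\<bar>)"
    have "integrable lborel (\<lambda>y. indicator {0..T} y *\<^sub>R h y)"
    proof (rule Bochner_Integration.integrable_bound)
      show "integrable lborel (\<lambda>y. ?c *\<^sub>R (exp (- (of_real (w + 1 / Suc 0) * of_real y)) * h y))"
        by (intro integrable_scaleR_right int)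
      have "norm (indicator {0..T} y *\<^sub>R h y)
        \<le> norm (?c *\<^sub>R (exp (- (of_real (w + 1 / Suc 0) * of_real y)) * h y))" for y
      proof (cases "y \<in> {0..T}")
        case True
        have "(w + 1) * y \<le> \<bar>w + 1\<bar> * \<bar>T\<bar>"
          using True by (intro mult_mono) auto
        then have "1 \<le> ?c * exp (- ((w + 1) * y))"
          by (simp flip: exp_add)
        then have "1 * norm (h y) \<le> (?c * exp (- ((w + 1) * y))) * norm (h y)"
          by (rule mult_right_mono) simp
        then show ?thesis using True by (simp add: norm_mult mult.assoc)
      qed simp
      then show "AE y in lborel. norm (indicator {0..T} y *\<^sub>R h y)
        \<le> norm (?c *\<^sub>R (exp (- (of_real (w + 1 / Suc 0) * of_real y)) * h y))" by simp
    qed measurable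
    then show "h absolutely_integrable_on {0..T}"
      unfolding set_integrable_def by (subst integrable_completion) auto
  qed
  moreover have "laplace_abscissa h < ereal (Re (\<mu> k))" for k
  proof -
    obtain n where n: "1 / Suc n < Re (\<mu> k) - w"
      using w[of k] nat_approx_posE[of "Re (\<mu> k) - w"] by auto
    have "laplace_abscissa h \<le> ereal (Re (of_real (w + 1 / Suc n)))"
      unfolding laplace_abscissa_def
      by (rule Inf_lower) (use has_laplace_integral[OF assms(3) neg int[of n]] in blast)
    also have "\<dots> < ereal (Re (\<mu> k))" using n by simp
    finally show ?thesis .
  qed
  moreover have "has_laplace h (\<mu> k) 0" for k
    using has_laplace_integral[OF assms(3) neg zero(1)] zero(2) by simp
  ultimately have "AE y in lebesgue. 0 \<le> y \<longrightarrow> h y = 0"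
    using uniq unfolding laplace_uniqueness_seq_def by blast
  then have "AE y in lborel. 0 \<le> y \<longrightarrow> h y = 0"
    by (simp add: AE_completion_iff)
  then show ?thesis
    by eventually_elim (use neg in force)
qed

lemma PiM_insert_eq_distr:
  fixes M :: "'i \<Rightarrow> 'a measure"
  assumes "product_sigma_finite M" and I: "finite I" "i \<notin> I"
  shows "distr (Pi\<^sub>M I M \<Otimes>\<^sub>M M i) (Pi\<^sub>M (insert i I) M) (\<lambda>(x, y). x(i := y)) = Pi\<^sub>M (insert i I) M"
proof -
  interpret product_sigma_finite M by fact
  interpret I: finite_product_sigma_finite M I by standard fact
  interpret M: sigma_finite_measure "M i" by (rule sigma_finite_measures)
  have [measurable]: "(\<lambda>(x, y). x(i := y)) \<in> measurable (Pi\<^sub>M I M \<Otimes>\<^sub>M M i) (Pi\<^sub>M (insert i I) M)"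
    by (rule measurable_add_dim)
  show ?thesis
  proof (rule measure_eqI)
    fix A assume "A \<in> sets (distr (Pi\<^sub>M I M \<Otimes>\<^sub>M M i) (Pi\<^sub>M (insert i I) M) (\<lambda>(x, y). x(i := y)))"
    then have A[measurable]: "A \<in> sets (Pi\<^sub>M (insert i I) M)" by simp
    have "emeasure (distr (Pi\<^sub>M I M \<Otimes>\<^sub>M M i) (Pi\<^sub>M (insert i I) M) (\<lambda>(x, y). x(i := y))) A
        = (\<integral>\<^sup>+x. indicator A x \<partial>distr (Pi\<^sub>M I M \<Otimes>\<^sub>M M i) (Pi\<^sub>M (insert i I) M) (\<lambda>(x, y). x(i := y)))"
      by simp
    also have "\<dots> = (\<integral>\<^sup>+p. indicator A ((\<lambda>(x, y). x(i := y)) p) \<partial>(Pi\<^sub>M I M \<Otimes>\<^sub>M M i))"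
      by (rule nn_integral_distr) auto
    also have "\<dots> = (\<integral>\<^sup>+x. \<integral>\<^sup>+y. indicator A (x(i := y)) \<partial>M i \<partial>Pi\<^sub>M I M)"
      by (subst M.nn_integral_fst[symmetric]) auto
    also have "\<dots> = (\<integral>\<^sup>+x. indicator A x \<partial>Pi\<^sub>M (insert i I) M)"
      by (rule product_nn_integral_insert[OF I, symmetric]) auto
    finally show "emeasure (distr (Pi\<^sub>M I M \<Otimes>\<^sub>M M i) (Pi\<^sub>M (insert i I) M) (\<lambda>(x, y). x(i := y))) A
        = emeasure (Pi\<^sub>M (insert i I) M) A" by simp
  qed simp
qed

text \<open>
  Induction on the set of coordinates. For a new coordinate \<open>i\<close> and fixed \<open>k\<close>, integrating
  \<open>H\<close> against \<open>exp(- \<lambda>\<^bsub>i,k\<^esub> y)\<close> in that coordinate gives a function of the remaining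
  coordinates satisfying the hypotheses again, so it vanishes almost everywhere. There are only countably
  many \<open>k\<close>; hence for almost every choice of the remaining coordinates the slice of \<open>H\<close> has
  a transform vanishing at all \<open>\<lambda>\<^bsub>i,k\<^esub>\<close>, and one-dimensional uniqueness applies to it. The
  integrability hypothesis ranges over the open region \<open>\<omega>\<^sub>i < Re z\<^sub>i\<close> so that it is inherited by
  these functions and yields the abscissa of the slices.
\<close>

lemma laplace_uniqueness_PiM:
  fixes lam :: "'i \<Rightarrow> nat \<Rightarrow> complex" and \<omega> :: "'i \<Rightarrow> real" and H :: "('i \<Rightarrow> real) \<Rightarrow> complex"
  assumes "finite I"
    and "\<And>i. i \<in> I \<Longrightarrow> laplace_uniqueness_seq (lam i)" "\<And>i k. i \<in> I \<Longrightarrow> \<omega> i < Re (lam i k)"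
    and "H \<in> borel_measurable (Pi\<^sub>M I (\<lambda>_. lborel))"
    and "\<And>x i. i \<in> I \<Longrightarrow> x i < 0 \<Longrightarrow> H x = 0"
    and "\<And>z. (\<And>i. i \<in> I \<Longrightarrow> \<omega> i < Re (z i)) \<Longrightarrow>
      integrable (Pi\<^sub>M I (\<lambda>_. lborel)) (\<lambda>x. exp (- (\<Sum>i\<in>I. z i * of_real (x i))) * H x)"
    and "\<And>\<kappa>. (\<integral>x. exp (- (\<Sum>i\<in>I. lam i (\<kappa> i) * of_real (x i))) * H x \<partial>Pi\<^sub>M I (\<lambda>_. lborel)) = 0"
  shows "AE x in Pi\<^sub>M I (\<lambda>_. lborel). H x = 0"
  using assms
proof (induction I arbitrary: H)
  case empty
  interpret product_sigma_finite "\<lambda>_::'i. lborel :: real measure" by standard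
  have "H (\<lambda>_. undefined) = 0"
    using empty.prems(6)[of "\<lambda>_. 0"] by (simp add: PiM_empty lebesgue_integral_count_space_finite)
  then show ?case unfolding PiM_empty by (simp add: AE_count_space)
next
  case (insert i I)
  let ?M = "\<lambda>J :: 'i set. Pi\<^sub>M J (\<lambda>_. lborel :: real measure)"
  have psf: "product_sigma_finite (\<lambda>_::'i. lborel :: real measure)" by standard
  interpret product_sigma_finite "\<lambda>_::'i. lborel :: real measure" by fact
  interpret I: finite_product_sigma_finite "\<lambda>_::'i. lborel :: real measure" I by standard fact
  interpret P: pair_sigma_finite "?M I" "lborel :: real measure" by standard
  note distr = PiM_insert_eq_distr[OF psf insert.hyps]
  have [measurable]: "(\<lambda>(x, y). x(i := y)) \<in> measurable (?M I \<Otimes>\<^sub>M lborel) (?M (insert i I))"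
    by (rule measurable_add_dim)
  note [measurable] = insert.prems(3)
  have Hm [measurable]: "(\<lambda>p. H ((fst p)(i := snd p))) \<in> borel_measurable (?M I \<Otimes>\<^sub>M lborel)"
    using measurable_compose[OF \<open>(\<lambda>(x, y). x(i := y)) \<in> _\<close> insert.prems(3)]
    by (simp add: case_prod_unfold)
  have exp_split: "exp (- (\<Sum>j\<in>insert i I. z j * of_real ((x(i := y)) j)))
      = exp (- (\<Sum>j\<in>I. z j * of_real (x j))) * exp (- (z i * of_real y))" for z :: "'i \<Rightarrow> complex" and x y
  proof -
    have "(\<Sum>j\<in>I. z j * of_real ((x(i := y)) j)) = (\<Sum>j\<in>I. z j * of_real (x j))"
      using insert.hyps by (intro sum.cong) auto
    then show ?thesis
      using insert.hyps by (simp add: mult_exp_exp algebra_simps)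
  qed
  have int_pair: "integrable (?M I \<Otimes>\<^sub>M lborel) (\<lambda>(x, y).
      exp (- (\<Sum>j\<in>I. z j * of_real (x j))) * (exp (- (a * of_real y)) * H (x(i := y))))"
    if z: "\<And>j. j \<in> I \<Longrightarrow> \<omega> j < Re (z j)" and a: "\<omega> i < Re a" for z a
  proof -
    let ?z = "z(i := a)"
    have "integrable (?M (insert i I)) (\<lambda>x. exp (- (\<Sum>j\<in>insert i I. ?z j * of_real (x j))) * H x)"
      by (rule insert.prems(5)) (use z a in auto)
    then have "integrable (?M I \<Otimes>\<^sub>M lborel) (\<lambda>p.
        exp (- (\<Sum>j\<in>insert i I. ?z j * of_real (((\<lambda>(x, y). x(i := y)) p) j))) * H ((\<lambda>(x, y). x(i := y)) p))"
      by (subst (asm) distr[symmetric]) (simp add: integrable_distr_eq)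
    moreover have "(\<Sum>j\<in>I. ?z j * of_real (x j)) = (\<Sum>j\<in>I. z j * of_real (x j))" for x :: "'i \<Rightarrow> real"
      using insert.hyps by (intro sum.cong) auto
    ultimately show ?thesis
      unfolding case_prod_unfold exp_split by (simp add: mult.assoc)
  qed
  have slice_int: "AE x in ?M I. integrable lborel (\<lambda>y. exp (- (a * of_real y)) * H (x(i := y)))"
    if "\<omega> i < Re a" for a
  proof -
    \<comment> \<open>Any admissible exponents for the coordinates in \<open>I\<close> would do here: their exponential is
      a nonzero constant on each slice.\<close>
    have "AE x in ?M I. integrable lborel (\<lambda>y. exp (- (\<Sum>j\<in>I. of_real (\<omega> j + 1) * of_real (x j)))
        * (exp (- (a * of_real y)) * H (x(i := y))))"
      using P.AE_integrable_fst'[OF int_pair[of "\<lambda>j. of_real (\<omega> j + 1)", OF _ that]] by simp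
    then show ?thesis
    proof eventually_elim
      case (elim x)
      from integrable_mult_right[OF elim, of "exp (\<Sum>j\<in>I. of_real (\<omega> j + 1) * of_real (x j))"]
      show ?case
        by (simp add: mult_exp_exp flip: mult.assoc)
    qed
  qed
  define G where "G k x = (\<integral>y. exp (- (lam i k * of_real y)) * H (x(i := y)) \<partial>lborel)" for k x
  have G: "AE x in ?M I. G k x = 0" for k
  proof (rule insert.IH)
    show "G k \<in> borel_measurable (?M I)"
      unfolding G_def by measurable
    show "G k x = 0" if "j \<in> I" "x j < 0" for x j
    proof -
      have "H (x(i := y)) = 0" for y
        by (rule insert.prems(4)[of j]) (use insert.hyps that in auto)
      then show ?thesis by (simp add: G_def)
    qed
    show "integrable (?M I) (\<lambda>x. exp (- (\<Sum>j\<in>I. z j * of_real (x j))) * G k x)"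
      if "\<And>j. j \<in> I \<Longrightarrow> \<omega> j < Re (z j)" for z
      using P.integrable_fst'[OF int_pair[of z "lam i k", OF that insert.prems(2)]]
      by (simp add: G_def)
    show "(\<integral>x. exp (- (\<Sum>j\<in>I. lam j (\<kappa> j) * of_real (x j))) * G k x \<partial>?M I) = 0" for \<kappa>
    proof -
      let ?k = "\<kappa>(i := k)"
      have "0 = (\<integral>x. exp (- (\<Sum>j\<in>insert i I. lam j (?k j) * of_real (x j))) * H x \<partial>?M (insert i I))"
        by (rule insert.prems(6)[symmetric])
      also have "\<dots> = (\<integral>x. \<integral>y. exp (- (\<Sum>j\<in>insert i I. lam j (?k j) * of_real ((x(i := y)) j))) * H (x(i := y)) \<partial>lborel \<partial>?M I)"
        by (rule product_integral_insert[OF insert.hyps insert.prems(5)]) (use insert.prems(2) in auto)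
      also have "\<dots> = (\<integral>x. exp (- (\<Sum>j\<in>I. lam j (\<kappa> j) * of_real (x j))) * G k x \<partial>?M I)"
      proof -
        have "(\<Sum>j\<in>I. lam j (?k j) * of_real (x j)) = (\<Sum>j\<in>I. lam j (\<kappa> j) * of_real (x j))" for x :: "'i \<Rightarrow> real"
          using insert.hyps by (intro sum.cong) auto
        then show ?thesis
          unfolding exp_split G_def by (simp add: mult.assoc)
      qed
      finally show ?thesis by simp
    qed
  qed (use insert.prems in auto)
  have "AE x in ?M I. AE y in lborel. H (x(i := y)) = 0"
  proof -
    have "AE x in ?M I. \<forall>n::nat. integrable lborel (\<lambda>y. exp (- (of_real (\<omega> i + 1 / Suc n) * of_real y)) * H (x(i := y)))"
      unfolding AE_all_countable by (intro allI slice_int) simp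
    moreover have "AE x in ?M I. \<forall>k. integrable lborel (\<lambda>y. exp (- (lam i k * of_real y)) * H (x(i := y)))"
      unfolding AE_all_countable by (intro allI slice_int insert.prems) simp
    moreover have "AE x in ?M I. \<forall>k. G k x = 0"
      unfolding AE_all_countable by (intro allI G)
    ultimately show ?thesis
      using AE_space
    proof eventually_elim
      case (elim x)
      show ?case
      proof (rule laplace_uniqueness_AE[of "lam i" "\<omega> i"])
        show "(\<lambda>y. H (x(i := y))) \<in> borel_measurable borel"
          using measurable_compose[OF measurable_component_update[OF elim(4) insert.hyps(2)] insert.prems(3)]
          by (simp add: fun_upd_def)
        show "H (x(i := y)) = 0" if "y < 0" for y
          by (rule insert.prems(4)[of i]) (use that in auto)
      qed (use elim insert.prems in \<open>auto simp: G_def\<close>)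
    qed
  qed
  moreover have "{p \<in> space (?M I \<Otimes>\<^sub>M lborel). H ((fst p)(i := snd p)) = 0} \<in> sets (?M I \<Otimes>\<^sub>M lborel)"
    by measurable
  ultimately have "AE p in ?M I \<Otimes>\<^sub>M lborel. H ((fst p)(i := snd p)) = 0"
    by (intro P.AE_pair_measure) simp_all
  then have "AE p in ?M I \<Otimes>\<^sub>M lborel. H ((\<lambda>(x, y). x(i := y)) p) = 0"
    by (simp only: case_prod_unfold)
  then show ?case
    by (subst distr[symmetric], subst AE_distr_iff) auto
qed

section \<open>From one variable to several\<close>

lemma Union_boxes: "(\<Union>N::nat. {0..(\<chi> i. real N)}) = {0 :: real ^ 'n..}"
proof (intro equalityI subsetI)
  fix x :: "real ^ 'n" assume x: "x \<in> {0..}"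
  obtain N where N: "norm x \<le> real N" using real_arch_simple by blast
  have "x $ i \<le> real N" for i
    using N component_le_norm_cart[of x i] by linarith
  then show "x \<in> (\<Union>N::nat. {0..(\<chi> i. real N)})"
    using x by (auto simp: less_eq_vec_def)
qed auto

lemma incseq_boxes: "incseq (\<lambda>N::nat. {0..(\<chi> i. real N) :: real ^ 'n})"
  by (auto simp: incseq_def less_eq_vec_def)

lemma measurable_box [measurable]: "{0..t} \<in> sets borel" "{0 :: real ^ 'n..} \<in> sets borel" for t :: "real ^ 'n"
proof -
  have [simp]: "{0..t} \<in> sets borel" for t :: "real ^ 'n"
  proof -
    have "{0..t} = cbox 0 t" by (auto simp: mem_box_cart less_eq_vec_def)
    then show ?thesis by simp
  qed
  show "{0..t} \<in> sets borel" by simp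
  show "{0 :: real ^ 'n..} \<in> sets borel" unfolding Union_boxes[symmetric] by auto
qed

text \<open>
  Every box just above \<open>t\<close> has positive measure and so contains a zero of the primitive. Along
  a sequence of such zeros converging to \<open>t\<close> from above, the indicators of \<open>[0,r]\<close> converge
  pointwise to that of \<open>[0,t]\<close>, and dominated convergence applies.
\<close>

lemma primitive_eq_0_if_AE:
  fixes f :: "real ^ 'n \<Rightarrow> complex"
  assumes [measurable]: "f \<in> borel_measurable borel"
    and f_int: "\<And>t. integrable lborel (\<lambda>s. indicator {0..t} s *\<^sub>R f s)"
    and AE: "AE r in lborel. 0 \<le> r \<longrightarrow> multi_laplace_partial f 0 r = 0"
    and t: "0 \<le> t"
  shows "multi_laplace_partial f 0 t = 0"
proof -
  note mlp = multi_laplace_partial_lborel[OF assms(1) f_int]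
  define u where "u N = t + (\<chi> i. 1 / Suc N)" for N
  have "\<exists>r \<in> box t (u N). multi_laplace_partial f 0 r = 0" for N
  proof (rule ccontr)
    assume none: "\<not> ?thesis"
    have ge: "0 \<le> r" if "r \<in> box t (u N)" for r
      using that t by (auto simp: mem_box_cart less_eq_vec_def) (meson less_imp_le order_trans)
    have "AE r in lborel. r \<notin> box t (u N)"
      using AE by eventually_elim (use none ge in blast)
    then have "box t (u N) \<in> null_sets lborel"
      by (subst (asm) AE_iff_null_sets[symmetric]) auto
    then have "negligible (box t (u N))"
      by (simp add: negligible_iff_null_sets null_sets_completionI)
    moreover have "t + (\<chi> i. 1 / (2 * Suc N)) \<in> box t (u N)"
      by (auto simp: mem_box_cart u_def field_simps)
    ultimately show False
      using open_not_negligible[OF open_box] by blast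
  qed
  then obtain r where r: "\<And>N. r N \<in> box t (u N)" "\<And>N. multi_laplace_partial f 0 (r N) = 0"
    by metis
  have t_le: "t \<le> r N" and r_le: "r N \<le> u 0" for N
  proof -
    show "t \<le> r N" using r(1)[of N] by (auto simp: mem_box_cart less_eq_vec_def less_imp_le)
    show "r N \<le> u 0"
      unfolding less_eq_vec_def
    proof
      fix i
      have "r N $ i \<le> t $ i + 1 / Suc N"
        using r(1)[of N] by (auto simp: mem_box_cart u_def less_imp_le)
      also have "\<dots> \<le> u 0 $ i" by (simp add: u_def)
      finally show "r N $ i \<le> u 0 $ i" .
    qed
  qed
  have "(\<lambda>N. \<integral>s. indicator {0..r N} s *\<^sub>R f s \<partial>lborel) \<longlonglongrightarrow> (\<integral>s. indicator {0..t} s *\<^sub>R f s \<partial>lborel)"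
  proof (rule integral_dominated_convergence)
    show "integrable lborel (\<lambda>s. norm (indicator {0..u 0} s *\<^sub>R f s))"
      by (intro integrable_norm f_int)
    show "AE s in lborel. (\<lambda>N. indicator {0..r N} s *\<^sub>R f s) \<longlonglongrightarrow> indicator {0..t} s *\<^sub>R f s"
    proof (intro AE_I2 tendsto_eventually)
      fix s :: "real ^ 'n"
      show "eventually (\<lambda>N. indicator {0..r N} s *\<^sub>R f s = indicator {0..t} s *\<^sub>R f s) sequentially"
      proof (cases "s \<le> t")
        case True
        then have "s \<le> r N" for N using t_le order_trans by blast
        with True show ?thesis by (simp add: indicator_def)
      next
        case False
        then obtain i where i: "t $ i < s $ i" by (auto simp: less_eq_vec_def not_le)
        obtain M where M: "1 / Suc M < s $ i - t $ i"
          using nat_approx_posE[of "s $ i - t $ i"] i by auto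
        have "\<not> s \<le> r N" if "M \<le> N" for N
        proof -
          have "r N $ i \<le> t $ i + 1 / Suc N"
            using r(1)[of N] by (auto simp: mem_box_cart u_def less_imp_le)
          also have "1 / Suc N \<le> 1 / Suc M" using that by (simp add: frac_le)
          finally have "r N $ i < s $ i" using M by linarith
          then show ?thesis by (auto simp: less_eq_vec_def not_le)
        qed
        then have "eventually (\<lambda>N. \<not> s \<le> r N) sequentially"
          by (auto simp: eventually_sequentially)
        then show ?thesis
          by eventually_elim (use False in \<open>simp add: indicator_def\<close>)
      qed
    qed
    show "AE s in lborel. norm (indicator {0..r N} s *\<^sub>R f s) \<le> norm (indicator {0..u 0} s *\<^sub>R f s)" for N
      using order_trans[OF _ r_le[of N]] by (intro AE_I2) (auto split: split_indicator)
  qed measurable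
  moreover have "(\<lambda>N. \<integral>s. indicator {0..r N} s *\<^sub>R f s \<partial>lborel) = (\<lambda>N. 0)"
    using r(2) by (simp add: mlp fun_eq_iff)
  ultimately show ?thesis
    by (simp add: mlp LIMSEQ_const_iff)
qed

text \<open>
  The function is replaced by a Borel version \<open>f\<close> and \<open>\<omega>\<close> by \<open>max 0 \<omega>\<close>. On the grid the
  transform of the primitive vanishes because it is that of \<open>f\<close> divided by a nonzero product, so
  \<open>laplace_uniqueness_PiM\<close> applies to the primitive.
\<close>

lemma multi_laplace_uniqueness_grid:
  fixes lam :: "'n::finite \<Rightarrow> nat \<Rightarrow> complex"
  assumes pos: "\<And>j k. 0 < Re (lam j k)" and uniq: "\<And>j. laplace_uniqueness_seq (lam j)"
  shows "multi_laplace_uniqueness (\<lambda>\<kappa> :: nat ^ 'n. \<chi> j. lam j (\<kappa> $ j))"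
  unfolding multi_laplace_uniqueness_def
proof (intro allI impI)
  fix g :: "real ^ 'n \<Rightarrow> complex"
  assume li: "multi_loc_integrable g"
    and "\<exists>\<omega> :: 'n \<Rightarrow> ereal. (\<forall>j. \<omega> j < \<infinity>) \<and>
        {z. \<forall>j. \<omega> j < ereal (Re (z $ j))} \<subseteq> laplace_Omega_b g \<inter> laplace_Omega g \<and>
        (\<forall>(\<kappa> :: nat ^ 'n) j. \<omega> j < ereal (Re ((\<chi> j. lam j (\<kappa> $ j)) $ j)))"
    and zeros: "\<forall>\<kappa> :: nat ^ 'n. has_multi_laplace g (\<chi> j. lam j (\<kappa> $ j)) 0"
  then obtain \<omega> :: "'n \<Rightarrow> ereal" where \<omega>: "\<And>j. \<omega> j < \<infinity>"
      "{z. \<forall>j. \<omega> j < ereal (Re (z $ j))} \<subseteq> laplace_Omega_b g \<inter> laplace_Omega g"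
      "\<And>(\<kappa> :: nat ^ 'n) j. \<omega> j < ereal (Re (lam j (\<kappa> $ j)))"
    by auto
  obtain f where f[measurable]: "f \<in> borel_measurable borel" and f_supp: "\<And>x. x \<notin> {0..} \<Longrightarrow> f x = 0"
    and fg: "AE x in lborel. x \<in> {0..} \<longrightarrow> g x = f x"
    and f_eq: "\<And>B k. B \<in> sets borel \<Longrightarrow> B \<subseteq> {0..} \<Longrightarrow> k \<in> borel_measurable borel \<Longrightarrow>
      (LINT x:B|lebesgue. k x * g x) = (LINT x:B|lborel. k x * f x)"
    and f_box: "\<And>N::nat. set_integrable lborel {0..(\<chi> i. real N)} f"
    using ex_borel_version_on_union[OF _ incseq_boxes measurable_box(1) Union_boxes, of g] li
    unfolding multi_loc_integrable_def by blast
  have f_int: "integrable lborel (\<lambda>s. indicator {0..t} s *\<^sub>R f s)" for t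
  proof -
    obtain N where "norm t \<le> real N" using real_arch_simple by blast
    then have "t $ i \<le> real N" for i
      using component_le_norm_cart[of t i] by linarith
    then have "{0..t} \<subseteq> {0..(\<chi> i. real N)}" by (auto simp: less_eq_vec_def intro: order_trans)
    then have "set_integrable lborel {0..t} f"
      by (rule set_integrable_subset[OF f_box, rotated]) simp
    then show ?thesis by (simp add: set_integrable_def)
  qed
  note mlp = multi_laplace_partial_lborel[OF f f_int]
  have partial_eq: "multi_laplace_partial g = multi_laplace_partial f"
  proof (intro ext)
    fix z :: "complex ^ 'n" and t :: "real ^ 'n"
    have "multi_laplace_partial g z t = (LINT s:{0..t}|lborel. laplace_kernel z s * f s)"
      unfolding multi_laplace_partial_def laplace_kernel_def[symmetric] by (rule f_eq) auto
    then show "multi_laplace_partial g z t = multi_laplace_partial f z t"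
      by (simp add: mlp set_lebesgue_integral_def)
  qed
  \<comment> \<open>Positivity of the real parts on the grid allows the passage to nonnegative finite bounds.\<close>
  define w where "w j = real_of_ereal (max 0 (\<omega> j))" for j
  have w: "ereal (w j) = max 0 (\<omega> j)" for j
    unfolding w_def using \<omega>(1)[of j] by (intro ereal_real') (auto simp: max_def)
  have w_nonneg: "0 \<le> w j" for j
    using w[of j] by (metis ereal_less_eq(5) max.cobounded1)
  have w_gt: "\<omega> j < ereal x" if "w j < x" for j x
  proof -
    have "\<omega> j \<le> ereal (w j)" by (simp add: w)
    also have "\<dots> < ereal x" using that by simp
    finally show ?thesis .
  qed
  have w_lam: "w j < Re (lam j k)" for j k
  proof -
    have "ereal (w j) < ereal (Re (lam j k))"
      using \<omega>(3)[of j "\<chi> _. k"] pos[of j k] by (simp add: w)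
    then show ?thesis by simp
  qed
  have Omega_b: "z \<in> laplace_Omega_b f" if "\<And>j. w j < Re (z $ j)" for z
    using \<omega>(2) w_gt that unfolding laplace_Omega_b_def partial_eq by blast
  let ?P = "multi_laplace_partial f 0"
  let ?M = "Pi\<^sub>M (UNIV :: 'n set) (\<lambda>_. lborel :: real measure)"
  define H where "H x = indicator {0..} (\<chi> i. x i) *\<^sub>R ?P (\<chi> i. x i)" for x :: "'n \<Rightarrow> real"
  have [measurable]: "?P \<in> borel_measurable borel"
    by (rule measurable_multi_laplace_partial[OF f f_int])
  have kernel_H: "exp (- (\<Sum>i\<in>UNIV. z i * of_real (x i))) * H x
      = indicator {0..} (\<chi> i. x i) *\<^sub>R (laplace_kernel (\<chi> i. z i) (\<chi> i. x i) * ?P (\<chi> i. x i))"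
    for z :: "'n \<Rightarrow> complex" and x
    by (simp add: H_def laplace_kernel_def)
  have "AE x in ?M. H x = 0"
  proof (rule laplace_uniqueness_PiM[where lam=lam and \<omega>=w])
    show "H \<in> borel_measurable ?M" unfolding H_def by measurable
    show "H x = 0" if "x i < 0" for x i
    proof -
      have "\<not> 0 \<le> (\<chi> i. x i)" using that by (auto simp: less_eq_vec_def not_le)
      then show ?thesis by (simp add: H_def)
    qed
    show "integrable ?M (\<lambda>x. exp (- (\<Sum>i\<in>UNIV. z i * of_real (x i))) * H x)"
      if "\<And>i. i \<in> UNIV \<Longrightarrow> w i < Re (z i)" for z
    proof -
      have "integrable lborel (\<lambda>r. indicator {0..} r *\<^sub>R (laplace_kernel (\<chi> i. z i) r * ?P r))"
        by (rule integrable_laplace_kernel_primitive[OF f f_int w_nonneg Omega_b]) (use that in auto)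
      then show ?thesis
        unfolding kernel_H
        by (subst (asm) lborel_vec_eq_distr_PiM, subst (asm) integrable_distr_eq) auto
    qed
    show "(\<integral>x. exp (- (\<Sum>i\<in>UNIV. lam i (\<kappa> i) * of_real (x i))) * H x \<partial>?M) = 0" for \<kappa>
    proof -
      let ?z = "\<chi> i. lam i (\<kappa> i)"
      have L: "has_multi_laplace f ?z 0"
        using zeros[rule_format, of "\<chi> i. \<kappa> i"] unfolding has_multi_laplace_def partial_eq by simp
      have "(\<Prod>i\<in>UNIV. ?z $ i) * (\<integral>r. indicator {0..} r *\<^sub>R (laplace_kernel ?z r * ?P r) \<partial>lborel) = 0"
      proof (rule laplace_transform_primitive[OF f f_int w_nonneg Omega_b _ L])
        show "w j < Re (?z $ j)" for j using w_lam[of j "\<kappa> j"] by simp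
      qed
      moreover have "lam i (\<kappa> i) \<noteq> 0" for i using pos[of i "\<kappa> i"] by auto
      ultimately have "(\<integral>r. indicator {0..} r *\<^sub>R (laplace_kernel ?z r * ?P r) \<partial>lborel) = 0"
        by simp
      then show ?thesis
        unfolding kernel_H
        by (subst (asm) lborel_vec_eq_distr_PiM, subst (asm) integral_distr) auto
    qed
  qed (use uniq w_lam in auto)
  then have "AE r in lborel. 0 \<le> r \<longrightarrow> ?P r = 0"
    by (subst lborel_vec_eq_distr_PiM, subst AE_distr_iff) (auto simp: H_def elim!: eventually_mono)
  note P0 = primitive_eq_0_if_AE[OF f f_int this]
  have "(\<integral>s. indicator {0..t} s *\<^sub>R f s \<partial>lborel) = 0" for t
  proof (cases "0 \<le> t")
    case True
    then show ?thesis using P0[OF True] by (simp add: mlp)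
  qed simp
  then have "AE x in lborel. f x = 0"
    by (intro AE_eq_0_if_box_integrals_0 f f_int) (auto intro: f_supp)
  then have "AE x in lborel. 0 \<le> x \<longrightarrow> g x = 0"
    using fg by eventually_elim auto
  then show "AE x in lebesgue. 0 \<le> x \<longrightarrow> g x = 0"
    by (rule AE_completion)
qed

section \<open>From several variables to one\<close>

lemma measurable_interval_indicator [measurable]:
  "(\<lambda>(r, s). indicator {0..r} (s :: real) :: real) \<in> borel_measurable (borel \<Otimes>\<^sub>M borel)"
  unfolding indicator_def by (simp add: case_prod_unfold) measurable

context
  fixes h :: "real \<Rightarrow> complex"
  assumes h_borel [measurable]: "h \<in> borel_measurable borel"
    and h_int: "\<And>t. integrable lborel (\<lambda>s. indicator {0..t} s *\<^sub>R h s)"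
begin

lemma integrable_laplace_integrand:
  "integrable lborel (\<lambda>s. indicator {0..t} s *\<^sub>R (exp (- (z * of_real s)) * h s))"
proof (rule Bochner_Integration.integrable_bound)
  show "integrable lborel (\<lambda>s. exp (\<bar>Re z\<bar> * \<bar>t\<bar>) *\<^sub>R (indicator {0..t} s *\<^sub>R h s))"
    by (intro integrable_scaleR_right h_int)
  have "norm (indicator {0..t} s *\<^sub>R (exp (- (z * of_real s)) * h s))
      \<le> norm (exp (\<bar>Re z\<bar> * \<bar>t\<bar>) *\<^sub>R (indicator {0..t} s *\<^sub>R h s))" for s
  proof (cases "s \<in> {0..t}")
    case True
    have "- (Re z * s) \<le> \<bar>Re z * s\<bar>" by simp
    also have "\<dots> \<le> \<bar>Re z\<bar> * \<bar>t\<bar>"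
      unfolding abs_mult using True by (intro mult_left_mono) auto
    finally show ?thesis using True by (simp add: norm_mult mult_right_mono)
  qed simp
  then show "AE s in lborel. norm (indicator {0..t} s *\<^sub>R (exp (- (z * of_real s)) * h s))
      \<le> norm (exp (\<bar>Re z\<bar> * \<bar>t\<bar>) *\<^sub>R (indicator {0..t} s *\<^sub>R h s))" by simp
qed measurable

lemma laplace_partial_bounded:
  assumes "has_laplace h z L"
  obtains C where "\<And>t. norm (laplace_partial h z t) \<le> C"
proof -
  have "eventually (\<lambda>t. norm (laplace_partial h z t - L) < 1) at_top"
    using assms unfolding has_laplace_def tendsto_iff dist_norm by (metis zero_less_one)
  then obtain T where T: "\<And>t. T \<le> t \<Longrightarrow> norm (laplace_partial h z t - L) < 1"
    unfolding eventually_at_top_linorder by blast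
  define K where "K = (\<integral>s. norm (indicator {0..T} s *\<^sub>R (exp (- (z * of_real s)) * h s)) \<partial>lborel)"
  show thesis
  proof (rule that[of "max K (1 + norm L)"])
    fix t
    show "norm (laplace_partial h z t) \<le> max K (1 + norm L)"
    proof (cases "T \<le> t")
      case True
      have "norm (laplace_partial h z t) \<le> norm (laplace_partial h z t - L) + norm L"
        using norm_triangle_ineq[of "laplace_partial h z t - L" L] by simp
      then show ?thesis using T[OF True] by linarith
    next
      case False
      have "norm (laplace_partial h z t) \<le> (\<integral>s. norm (indicator {0..t} s *\<^sub>R (exp (- (z * of_real s)) * h s)) \<partial>lborel)"
        unfolding laplace_partial_lborel[OF h_borel] by (rule integral_norm_bound)
      also have "\<dots> \<le> K"
        unfolding K_def
        by (rule integral_mono'[OF integrable_norm[OF integrable_laplace_integrand]])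
           (use False in \<open>auto split: split_indicator\<close>)
      finally show ?thesis by simp
    qed
  qed
qed

text \<open>
  Abel's argument: integration by parts turns the transform at \<open>z\<close> into \<open>w\<close> times the transform of
  the bounded function \<open>laplace_partial h z0\<close> at \<open>w = z - z0\<close>, which has positive real part.
\<close>

lemma has_laplace_half_plane:
  assumes z0: "has_laplace h z0 L0" and z: "Re z0 < Re z"
  shows "\<exists>L. has_laplace h z L"
proof -
  define w where "w = z - z0"
  have w: "0 < Re w" using z by (simp add: w_def)
  let ?F = "laplace_partial h z0"
  obtain C where C: "\<And>t. norm (?F t) \<le> C" using laplace_partial_bounded[OF z0] by blast
  have [measurable]: "?F \<in> borel_measurable borel"
    unfolding laplace_partial_lborel[OF h_borel, abs_def] by measurable
  let ?G = "\<lambda>r. indicator {0..} r *\<^sub>R (exp (- (w * of_real r)) * ?F r)"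
  have G: "integrable lborel ?G"
  proof (rule Bochner_Integration.integrable_bound)
    show "integrable lborel (\<lambda>r. C * (indicator {0..} r * exp (- (Re w * r))))"
      by (intro integrable_mult_right integrable_exp_decay w)
    have "norm (?G r) \<le> norm (C * (indicator {0..} r * exp (- (Re w * r))))" for r
      using C[of r] order_trans[OF norm_ge_zero C[of r]]
      by (auto simp: norm_mult abs_mult mult.commute[of C] split: split_indicator intro!: mult_left_mono)
    then show "AE r in lborel. norm (?G r) \<le> norm (C * (indicator {0..} r * exp (- (Re w * r))))" by simp
  qed measurable
  have eq: "laplace_partial h z t = exp (- (w * of_real t)) * ?F t
      + w * (\<integral>r. indicator {..t} r *\<^sub>R ?G r \<partial>lborel)" for t
  proof -
    let ?g = "\<lambda>s. indicator {0..t} s *\<^sub>R (exp (- (z0 * of_real s)) * h s)"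
    have "laplace_partial h z t = (\<integral>s. exp (- (w * of_real s)) * ?g s \<partial>lborel)"
      unfolding laplace_partial_lborel[OF h_borel]
      by (intro Bochner_Integration.integral_cong)
         (auto simp: w_def mult_exp_exp algebra_simps simp flip: mult.assoc)
    also have "\<dots> = exp (- (w * of_real t)) * (\<integral>s. ?g s \<partial>lborel)
      + w * (\<integral>r. indicator {0..t} r *\<^sub>R (exp (- (w * of_real r)) * (\<integral>s. indicator {..r} s *\<^sub>R ?g s \<partial>lborel)) \<partial>lborel)"
      by (rule integral_cexp_by_parts[OF sigma_finite_lborel integrable_laplace_integrand])
         (auto simp: indicator_def split: if_splits)
    also have "(\<integral>r. indicator {0..t} r *\<^sub>R (exp (- (w * of_real r)) * (\<integral>s. indicator {..r} s *\<^sub>R ?g s \<partial>lborel)) \<partial>lborel)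
        = (\<integral>r. indicator {..t} r *\<^sub>R ?G r \<partial>lborel)"
    proof (rule Bochner_Integration.integral_cong[OF refl])
      fix r
      show "indicator {0..t} r *\<^sub>R (exp (- (w * of_real r)) * (\<integral>s. indicator {..r} s *\<^sub>R ?g s \<partial>lborel))
          = indicator {..t} r *\<^sub>R ?G r"
      proof (cases "r \<in> {0..t}")
        case True
        have "(\<integral>s. indicator {..r} s *\<^sub>R ?g s \<partial>lborel) = ?F r"
          unfolding laplace_partial_lborel[OF h_borel]
          using True by (intro Bochner_Integration.integral_cong) (auto simp: indicator_def)
        then show ?thesis using True by simp
      qed (auto simp: indicator_def)
    qed
    finally show ?thesis by (simp add: laplace_partial_lborel)
  qed
  have "((\<lambda>t. exp (- (w * of_real t)) * ?F t) \<longlongrightarrow> 0) at_top"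
  proof (rule Lim_null_comparison)
    show "eventually (\<lambda>t. norm (exp (- (w * of_real t)) * ?F t) \<le> C * exp (- (Re w * t))) at_top"
      using C by (intro always_eventually allI) (simp add: norm_mult mult.commute[of C] mult_left_mono)
    have "((\<lambda>t. C * exp (- (Re w * t))) \<longlongrightarrow> C * 0) at_top"
      by (intro tendsto_mult_left filterlim_compose[OF exp_at_bot] filterlim_uminus_at_bot_at_top[THEN filterlim_compose]
            filterlim_tendsto_pos_mult_at_top[OF tendsto_const w] filterlim_ident)
    then show "((\<lambda>t. C * exp (- (Re w * t))) \<longlongrightarrow> 0) at_top" by simp
  qed
  then have "(laplace_partial h z \<longlongrightarrow> 0 + w * (\<integral>r. ?G r \<partial>lborel)) at_top"
    unfolding eq by (intro tendsto_add tendsto_mult_left tendsto_integral_at_top G) simp_all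
  then show ?thesis unfolding has_laplace_def by blast
qed

end

lemma filterlim_vec_nth_at_top: "filterlim (\<lambda>t :: real ^ 'n. t $ i) at_top at_top"
  unfolding filterlim_at_top eventually_at_top_vec by blast

lemma multi_laplace_partial_tensor:
  fixes \<phi> :: "'n::finite \<Rightarrow> real \<Rightarrow> complex"
  assumes [measurable]: "\<And>i. \<phi> i \<in> borel_measurable borel"
    and int: "\<And>i t. integrable lborel (\<lambda>s. indicator {0..t} s *\<^sub>R \<phi> i s)"
  defines "F \<equiv> (\<lambda>x :: real ^ 'n. \<Prod>i\<in>UNIV. \<phi> i (x $ i))"
  shows "multi_laplace_partial F z t = (\<Prod>i\<in>UNIV. laplace_partial (\<phi> i) (z $ i) (t $ i))"
    and "integrable lborel (\<lambda>s. indicator {0..t} s *\<^sub>R F s)"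
proof -
  have eq: "indicator {0..t} s *\<^sub>R (laplace_kernel z s * F s)
      = (\<Prod>i\<in>UNIV. indicator {0..t $ i} (s $ i) *\<^sub>R (exp (- (z $ i * of_real (s $ i))) * \<phi> i (s $ i)))" for s z
  proof (cases "s \<in> {0..t}")
    case True
    then show ?thesis
      by (auto simp: laplace_kernel_prod F_def less_eq_vec_def simp flip: prod.distrib intro!: prod.cong)
  next
    case False
    then obtain i where "s $ i \<notin> {0..t $ i}" by (auto simp: less_eq_vec_def)
    then have "\<exists>i. indicator {0..t $ i} (s $ i) *\<^sub>R (exp (- (z $ i * of_real (s $ i))) * \<phi> i (s $ i)) = 0"
      by (intro exI[of _ i]) simp
    then show ?thesis using False by (simp add: prod_zero_iff)
  qed
  note I = integrable_laplace_integrand[OF assms(1) int]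
  have [measurable]: "F \<in> borel_measurable borel" unfolding F_def by measurable
  show F: "integrable lborel (\<lambda>s. indicator {0..t} s *\<^sub>R F s)"
    using integrable_vec_prod[OF I, of "\<lambda>i. t $ i" "\<lambda>_. 0"] eq[where z=0] by simp
  have "multi_laplace_partial F z t = (\<integral>s. indicator {0..t} s *\<^sub>R (laplace_kernel z s * F s) \<partial>lborel)"
    unfolding multi_laplace_partial_def set_lebesgue_integral_def laplace_kernel_def[symmetric]
    by (rule integral_completion) measurable
  then show "multi_laplace_partial F z t = (\<Prod>i\<in>UNIV. laplace_partial (\<phi> i) (z $ i) (t $ i))"
    unfolding eq integral_vec_prod[OF I] laplace_partial_lborel[OF assms(1)] .
qed

text \<open>
  The integral of the absolute value of the tensor product is the product of the one-dimensional
  integrals, so one of these has to be zero.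
\<close>

lemma AE_tensor_eq_0_imp:
  fixes \<phi> :: "'n::finite \<Rightarrow> real \<Rightarrow> complex"
  assumes [measurable]: "\<And>i. \<phi> i \<in> borel_measurable borel"
    and AE: "AE x in lborel. (\<Prod>i\<in>UNIV. \<phi> i ((x :: real ^ 'n) $ i)) = 0"
  shows "\<exists>i. AE y in lborel. \<phi> i y = 0"
proof -
  interpret product_sigma_finite "\<lambda>_::'n. lborel :: real measure" by standard
  have "AE x in Pi\<^sub>M (UNIV :: 'n set) (\<lambda>_. lborel :: real measure). (\<Prod>i\<in>UNIV. \<phi> i (x i)) = 0"
    using AE by (subst (asm) lborel_vec_eq_distr_PiM, subst (asm) AE_distr_iff) auto
  then have "(\<integral>\<^sup>+x. (\<Prod>i\<in>UNIV. ennreal (norm (\<phi> i (x i)))) \<partial>Pi\<^sub>M (UNIV :: 'n set) (\<lambda>_. lborel :: real measure)) = 0"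
    by (subst nn_integral_0_iff_AE) (auto simp: prod_ennreal prod_norm)
  then have "(\<Prod>i\<in>UNIV. \<integral>\<^sup>+y. ennreal (norm (\<phi> i y)) \<partial>lborel) = 0"
    by (subst (asm) product_nn_integral_prod) auto
  then obtain i where "(\<integral>\<^sup>+y. ennreal (norm (\<phi> i y)) \<partial>lborel) = 0"
    by (auto simp: prod_zero_iff)
  then have "AE y in lborel. \<phi> i y = 0"
    by (subst (asm) nn_integral_0_iff_AE) auto
  then show ?thesis ..
qed

text \<open>
  The other factors of the tensor product are indicators of \<open>[0,1]\<close>. Their transforms converge
  everywhere, so \<open>- \<infinity>\<close> can be taken as the bound in these coordinates and the only
  constraint on the transform is the abscissa in the coordinate \<open>j\<close>.
\<close>

lemma laplace_uniqueness_seq_component: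
  fixes lam :: "'n::finite \<Rightarrow> nat \<Rightarrow> complex"
  assumes multi: "multi_laplace_uniqueness (\<lambda>\<kappa> :: nat ^ 'n. \<chi> j. lam j (\<kappa> $ j))"
  shows "laplace_uniqueness_seq (lam j)"
  unfolding laplace_uniqueness_seq_def
proof (intro allI impI)
  fix g :: "real \<Rightarrow> complex"
  assume li: "loc_integrable g" and absc: "\<forall>k. laplace_abscissa g < ereal (Re (lam j k))"
    and zeros: "\<forall>k. has_laplace g (lam j k) 0"
  have Union: "(\<Union>N::nat. {0..real N}) = {0..}"
    using real_arch_simple by (auto simp: Bex_def)
  have ivl: "{0..real N} \<in> sets borel" for N :: nat
    by simp
  have inc: "incseq (\<lambda>N::nat. {0..real N})"
    by (auto simp: incseq_def)
  obtain h where h[measurable]: "h \<in> borel_measurable borel" and h_supp: "\<And>x. x \<notin> {0..} \<Longrightarrow> h x = 0"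
    and gh: "AE x in lborel. x \<in> {0..} \<longrightarrow> g x = h x"
    and h_eq: "\<And>B k. B \<in> sets borel \<Longrightarrow> B \<subseteq> {0..} \<Longrightarrow> k \<in> borel_measurable borel \<Longrightarrow>
      (LINT x:B|lebesgue. k x * g x) = (LINT x:B|lborel. k x * h x)"
    and h_box: "\<And>N::nat. set_integrable lborel {0..real N} h"
    using ex_borel_version_on_union[OF _ inc ivl Union, of g] li
    unfolding loc_integrable_def by blast
  have h_int: "integrable lborel (\<lambda>s. indicator {0..t} s *\<^sub>R h s)" for t
  proof -
    obtain N where "t \<le> real N" using real_arch_simple by blast
    then have "set_integrable lborel {0..t} h"
      by (intro set_integrable_subset[OF h_box[of N]]) auto
    then show ?thesis by (simp add: set_integrable_def)
  qed
  have partial_eq: "laplace_partial g = laplace_partial h"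
  proof (intro ext)
    fix z t
    have "laplace_partial g z t = (LINT s:{0..t}|lborel. exp (- (z * of_real s)) * h s)"
      unfolding laplace_partial_def by (rule h_eq) auto
    then show "laplace_partial g z t = laplace_partial h z t"
      by (simp add: laplace_partial_lborel set_lebesgue_integral_def)
  qed
  have has_eq: "has_laplace g = has_laplace h"
    unfolding has_laplace_def[abs_def] partial_eq ..
  define \<phi> :: "'n \<Rightarrow> real \<Rightarrow> complex" where "\<phi> i = (if i = j then h else indicator {0..1})" for i
  define F where "F x = (\<Prod>i\<in>UNIV. \<phi> i (x $ i))" for x :: "real ^ 'n"
  have \<phi>_borel [measurable]: "\<phi> i \<in> borel_measurable borel" for i
    by (simp add: \<phi>_def)
  have unit_int: "integrable lborel (\<lambda>s. indicator {0..1} s *\<^sub>R exp (- (z * complex_of_real s)))" for z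
    by (rule integral_cexp_Icc(2)) simp
  have \<phi>_int: "integrable lborel (\<lambda>s. indicator {0..t} s *\<^sub>R \<phi> i s)" for t i
  proof (cases "i = j")
    case False
    have "integrable lborel (\<lambda>s. indicator {0..min t 1} s *\<^sub>R (1 :: complex))"
      by (intro integrable_scaleR_left integrable_real_indicator) (auto simp: emeasure_lborel_Icc_eq)
    then have "integrable lborel (\<lambda>s. indicator {0..t} s *\<^sub>R (indicator {0..1} s :: complex))"
      by (rule Bochner_Integration.integrable_cong[THEN iffD1, rotated 2]) (auto simp: indicator_def)
    then show ?thesis using False by (simp add: \<phi>_def)
  qed (simp add: \<phi>_def h_int)
  note tensor = multi_laplace_partial_tensor[of \<phi>, OF \<phi>_borel \<phi>_int, folded F_def]
  define \<omega> :: "'n \<Rightarrow> ereal" where "\<omega> i = (if i = j then laplace_abscissa g else - \<infinity>)" for i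
  have \<phi>_conv: "\<exists>L. has_laplace (\<phi> i) z L" if "\<omega> i < ereal (Re z)" for i z
  proof (cases "i = j")
    case True
    then have "laplace_abscissa g < ereal (Re z)" using that by (simp add: \<omega>_def)
    then obtain z0 L0 where "has_laplace h z0 L0" "Re z0 < Re z"
      unfolding laplace_abscissa_def Inf_less_iff has_eq by auto
    then show ?thesis
      using has_laplace_half_plane[OF h h_int] True by (simp add: \<phi>_def)
  next
    case False
    have "has_laplace (indicator {0..1}) z (\<integral>y. exp (- (z * of_real y)) * indicator {0..1} y \<partial>lborel)"
    proof (rule has_laplace_integral)
      show "integrable lborel (\<lambda>y. exp (- (z * of_real y)) * indicator {0..1} y)"
        using unit_int[of z]
        by (rule Bochner_Integration.integrable_cong[THEN iffD1, rotated 2]) (auto simp: indicator_def)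
    qed auto
    then show ?thesis using False by (auto simp: \<phi>_def)
  qed
  have transform: "has_multi_laplace F z (\<Prod>i\<in>UNIV. L i)" if "\<And>i. has_laplace (\<phi> i) (z $ i) (L i)" for z L
    unfolding has_multi_laplace_def tensor(1)[abs_def]
    by (intro tendsto_prod filterlim_compose[OF _ filterlim_vec_nth_at_top] that[unfolded has_laplace_def])
  have "multi_loc_integrable F"
    unfolding multi_loc_integrable_def set_integrable_def
  proof
    fix T :: real
    show "integrable lebesgue (\<lambda>x. indicator {0..\<chi> i. T} x *\<^sub>R F x)"
      using tensor(2)[of "\<chi> i. T"] by (subst integrable_completion) auto
  qed
  moreover have "\<exists>\<omega> :: 'n \<Rightarrow> ereal. (\<forall>i. \<omega> i < \<infinity>) \<and>
        {z. \<forall>i. \<omega> i < ereal (Re (z $ i))} \<subseteq> laplace_Omega_b F \<inter> laplace_Omega F \<and>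
        (\<forall>(\<kappa> :: nat ^ 'n) i. \<omega> i < ereal (Re ((\<chi> i. lam i (\<kappa> $ i)) $ i)))"
  proof (intro exI[of _ \<omega>] conjI allI subsetI IntI)
    show "\<omega> i < \<infinity>" for i
      using absc[rule_format, of 0] by (auto simp: \<omega>_def)
    show "\<omega> i < ereal (Re ((\<chi> i. lam i (\<kappa> $ i)) $ i))" for \<kappa> :: "nat ^ 'n" and i
      using absc by (simp add: \<omega>_def)
    fix z assume "z \<in> {z. \<forall>i. \<omega> i < ereal (Re (z $ i))}"
    then have "\<forall>i. \<exists>L. has_laplace (\<phi> i) (z $ i) L" using \<phi>_conv by blast
    then obtain L where L: "\<And>i. has_laplace (\<phi> i) (z $ i) (L i)" by metis
    show "z \<in> laplace_Omega F"
      using transform[OF L] by (auto simp: laplace_Omega_def)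
    have "\<forall>i. \<exists>C. \<forall>t. norm (laplace_partial (\<phi> i) (z $ i) t) \<le> C"
      using laplace_partial_bounded[OF \<phi>_borel \<phi>_int L] by metis
    then obtain C where C: "\<And>i t. norm (laplace_partial (\<phi> i) (z $ i) t) \<le> C i" by metis
    have "norm (multi_laplace_partial F z t) \<le> (\<Prod>i\<in>UNIV. C i)" for t
      unfolding tensor(1) prod_norm[symmetric] by (intro prod_mono) (simp add: C)
    then show "z \<in> laplace_Omega_b F"
      unfolding laplace_Omega_b_def bounded_iff by blast
  qed
  moreover have "has_multi_laplace F (\<chi> i. lam i (\<kappa> $ i)) 0" for \<kappa> :: "nat ^ 'n"
  proof -
    have "\<exists>L. has_laplace (\<phi> i) (lam i (\<kappa> $ i)) L \<and> (i = j \<longrightarrow> L = 0)" for i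
    proof (cases "i = j")
      case True
      then show ?thesis using zeros by (auto simp: \<phi>_def has_eq)
    next
      case False
      then show ?thesis using \<phi>_conv[of i] by (auto simp: \<omega>_def)
    qed
    then obtain L where L: "\<And>i. has_laplace (\<phi> i) (lam i (\<kappa> $ i)) (L i)" "L j = 0" by metis
    have "(\<Prod>i\<in>UNIV. L i) = 0" using L(2) by (auto simp: prod_zero_iff)
    moreover have "has_multi_laplace F (\<chi> i. lam i (\<kappa> $ i)) (\<Prod>i\<in>UNIV. L i)"
      by (rule transform) (simp add: L(1))
    ultimately show ?thesis by (simp only:)
  qed
  ultimately have "AE x in lebesgue. 0 \<le> x \<longrightarrow> F x = 0"
    using multi unfolding multi_laplace_uniqueness_def by blast
  moreover have "F x = 0" if x: "\<not> 0 \<le> x" for x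
  proof -
    obtain i where "\<not> 0 \<le> x $ i" using x unfolding less_eq_vec_def by auto
    then have "\<phi> i (x $ i) = 0" using h_supp by (auto simp: \<phi>_def)
    then show ?thesis unfolding F_def by (auto simp: prod_zero_iff)
  qed
  ultimately have "AE x in lebesgue. F x = 0"
    by (auto elim!: eventually_mono)
  then have "AE x in lborel. F x = 0"
    by (simp add: AE_completion_iff)
  then obtain i where i: "AE y in lborel. \<phi> i y = 0"
    using AE_tensor_eq_0_imp[of \<phi>, OF \<phi>_borel] unfolding F_def by blast
  have "i = j"
  proof (rule ccontr)
    assume "i \<noteq> j"
    then have "AE y in lborel. y \<notin> {0..1::real}"
      using i by (auto simp: \<phi>_def indicator_def elim!: eventually_mono split: if_splits)
    then have "{0..1::real} \<in> null_sets lborel"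
      by (subst (asm) AE_iff_null_sets[symmetric]) auto
    then show False by (simp add: null_sets_def)
  qed
  then have "AE y in lborel. h y = 0" using i by (simp add: \<phi>_def)
  then have "AE x in lborel. 0 \<le> x \<longrightarrow> g x = 0"
    using gh by eventually_elim auto
  then show "AE x in lebesgue. 0 \<le> x \<longrightarrow> g x = 0"
    by (rule AE_completion)
qed

theorem theorem2p6:
  fixes lam :: "'n::finite \<Rightarrow> nat \<Rightarrow> complex"
  assumes "\<And>j k. 0 < Re (lam j k)"
  shows "(\<forall>j. laplace_uniqueness_seq (lam j)) \<longleftrightarrow>
         multi_laplace_uniqueness (\<lambda>\<kappa> :: nat ^ 'n. \<chi> j. lam j (\<kappa> $ j))"
proof
  assume "\<forall>j. laplace_uniqueness_seq (lam j)"
  then show "multi_laplace_uniqueness (\<lambda>\<kappa> :: nat ^ 'n. \<chi> j. lam j (\<kappa> $ j))"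
    by (intro multi_laplace_uniqueness_grid assms) blast
next
  assume "multi_laplace_uniqueness (\<lambda>\<kappa> :: nat ^ 'n. \<chi> j. lam j (\<kappa> $ j))"
  then show "\<forall>j. laplace_uniqueness_seq (lam j)"
    by (intro allI laplace_uniqueness_seq_component)
qed

end
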